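(* Let $E,A\in\mathbb{R}^{n\times n}$ with $(E,A)$ regular, $B\in\mathbb{R}^{n\times m}$, $C\in\mathbb{R}^{m\times n}$, $D\in\mathbb{R}^{m\times m}$, and suppose the descriptor system $E\dot x=Ax+Bu$, $y=Cx+Du$ is completely controllable, completely observable, and positive real. Then the system is port-Hamiltonian if and only if $D+D^T\ge 0$.
   Context: For a real matrix $M$, $M\ge 0$ (resp. $M\le 0$) means $M$ is symmetric and positive (resp. negative) semidefinite; for complex matrices, Hermitian in place of symmetric. A descriptor system is identified with its quintuple $(E,A,B,C,D)$. Regular: $\det(\alpha E-\beta A)\ne 0$ for some $(\alpha,\beta)\in\mathbb{C}^2$. Completely controllable: $\operatorname{rank}[\alpha E-\beta A,\ B]=n$ for all $(\alpha,\beta)\in\mathbb{C}^2\setminus\{(0,0)\}$. Completely observable: $\operatorname{rank}\begin{bmatrix}\alpha E-\beta A\\ C\end{bmatrix}=n$ for all $(\alpha,\beta)\in\mathbb{C}^2\setminus\{(0,0)\}$. Positive real: the transfer function $\mathcal{T}(s)=C(sE-A)^{-1}B+D$ is analytic in $\mathbb{C}_+=\{s\in\mathbb{C}:\operatorname{Re}(s)>0\}$ and $\mathcal{T}(s)+\mathcal{T}(s)^H\ge 0$ for all $s\in\mathbb{C}_+$. Port-Hamiltonian (pH): there exist $J,R,Q\in\mathbb{R}^{n\times n}$ and $G,P\in\mathbb{R}^{n\times m}$ such that, with $S=\frac12(D+D^T)$ and $N=\frac12(D-D^T)$, $$\begin{bmatrix}A&B\\C&D\end{bmatrix}=\begin{bmatrix}(J-R)Q&G-P\\(G+P)^TQ&S+N\end{bmatrix},\qquad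 \begin{bmatrix}J&G\\-G^T&N\end{bmatrix}=-\begin{bmatrix}J&G\\-G^T&N\end{bmatrix}^T,$$ $$Q^TE=E^TQ\ge 0,\qquad \begin{bmatrix}Q^TRQ&Q^TP\\P^TQ&S\end{bmatrix}=\begin{bmatrix}Q^TRQ&Q^TP\\P^TQ&S\end{bmatrix}^T\ge 0.$$ *)

theory Defs
  imports "HOL-Analysis.Analysis"
begin

definition hcat :: "'a^'n^'k \<Rightarrow> 'a^'m^'k \<Rightarrow> 'a^('n + 'm)^'k" where
  "hcat X Y = (\<chi> i j. case j of Inl a \<Rightarrow> X $ i $ a | Inr b \<Rightarrow> Y $ i $ b)"

definition vcat :: "'a^'n^'k \<Rightarrow> 'a^'n^'l \<Rightarrow> 'a^'n^('k + 'l)" where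
  "vcat X Y = (\<chi> i. case i of Inl a \<Rightarrow> X $ a | Inr b \<Rightarrow> Y $ b)"

definition block_mat ::
  "'a^'n^'k \<Rightarrow> 'a^'m^'k \<Rightarrow> 'a^'n^'l \<Rightarrow> 'a^'m^'l \<Rightarrow> 'a^('n + 'm)^('k + 'l)" where
  "block_mat X Y Z W = vcat (hcat X Y) (hcat Z W)"

definition psd :: "real^'n^'n \<Rightarrow> bool" where
  "psd M \<longleftrightarrow> transpose M = M \<and> (\<forall>x. 0 \<le> x \<bullet> (M *v x))"

definition ctranspose :: "complex^'n^'m \<Rightarrow> complex^'m^'n" where
  "ctranspose M = map_matrix cnj (transpose M)"

(* For Hermitian M the quadratic form is real, so taking its real part loses nothing. *)
definition hermitian_psd :: "complex^'n^'n \<Rightarrow> bool" where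
  "hermitian_psd M \<longleftrightarrow>
     ctranspose M = M \<and> (\<forall>x. 0 \<le> Re (\<Sum>i\<in>UNIV. cnj (x $ i) * (M *v x) $ i))"

abbreviation cmat :: "real^'n^'m \<Rightarrow> complex^'n^'m" where
  "cmat \<equiv> map_matrix complex_of_real"

definition pencil :: "real^'n^'n \<Rightarrow> real^'n^'n \<Rightarrow> complex \<Rightarrow> complex \<Rightarrow> complex^'n^'n" where
  "pencil E A \<alpha> \<beta> = (\<chi> i j. \<alpha> * cmat E $ i $ j - \<beta> * cmat A $ i $ j)"

definition regular_pencil :: "real^'n^'n \<Rightarrow> real^'n^'n \<Rightarrow> bool" where
  "regular_pencil E A \<longleftrightarrow> (\<exists>\<alpha> \<beta>. det (pencil E A \<alpha> \<beta>) \<noteq> 0)"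

definition completely_controllable ::
  "real^'n^'n \<Rightarrow> real^'n^'n \<Rightarrow> real^'m^'n \<Rightarrow> bool" where
  "completely_controllable E A B \<longleftrightarrow>
     (\<forall>\<alpha> \<beta>. (\<alpha>, \<beta>) \<noteq> (0, 0) \<longrightarrow> rank (hcat (pencil E A \<alpha> \<beta>) (cmat B)) = CARD('n))"

definition completely_observable ::
  "real^'n^'n \<Rightarrow> real^'n^'n \<Rightarrow> real^'n^'p \<Rightarrow> bool" where
  "completely_observable E A C \<longleftrightarrow>
     (\<forall>\<alpha> \<beta>. (\<alpha>, \<beta>) \<noteq> (0, 0) \<longrightarrow> rank (vcat (pencil E A \<alpha> \<beta>) (cmat C)) = CARD('n))"

definition transfer ::
  "real^'n^'n \<Rightarrow> real^'n^'n \<Rightarrow> real^'m^'n \<Rightarrow> real^'n^'p \<Rightarrow> real^'m^'p \<Rightarrow> complex \<Rightarrow> complex^'m^'p"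
  where
  "transfer E A B C D s = cmat C ** matrix_inv (pencil E A s 1) ** cmat B + cmat D"

(* The transfer function is a rational matrix function. The formula above represents it only
   where s E - A is invertible (matrix_inv is unspecified elsewhere), so analyticity in the
   open right half-plane means that it has an analytic extension F to that half-plane,
   removable singularities being filled in. *)
definition positive_real ::
  "real^'n^'n \<Rightarrow> real^'n^'n \<Rightarrow> real^'m^'n \<Rightarrow> real^'n^'m \<Rightarrow> real^'m^'m \<Rightarrow> bool" where
  "positive_real E A B C D \<longleftrightarrow>
     (\<exists>F :: complex \<Rightarrow> complex^'m^'m.
        (\<forall>i j. (\<lambda>s. F s $ i $ j) analytic_on {s. 0 < Re s}) \<and>
        (\<forall>s. 0 < Re s \<and> det (pencil E A s 1) \<noteq> 0 \<longrightarrow> F s = transfer E A B C D s) \<and>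
        (\<forall>s. 0 < Re s \<longrightarrow> hermitian_psd (F s + ctranspose (F s))))"

definition port_hamiltonian ::
  "real^'n^'n \<Rightarrow> real^'n^'n \<Rightarrow> real^'m^'n \<Rightarrow> real^'n^'m \<Rightarrow> real^'m^'m \<Rightarrow> bool" where
  "port_hamiltonian E A B C D \<longleftrightarrow>
     (\<exists>(J :: real^'n^'n) (R :: real^'n^'n) (Q :: real^'n^'n) (G :: real^'m^'n) (P :: real^'m^'n).
        let S = (1 / 2) *\<^sub>R (D + transpose D);
            N = (1 / 2) *\<^sub>R (D - transpose D);
            K = block_mat J G (- transpose G) N;
            W = block_mat (transpose Q ** R ** Q) (transpose Q ** P) (transpose P ** Q) S
        in block_mat A B C D =
             block_mat ((J - R) ** Q) (G - P) (transpose (G + P) ** Q) (S + N) \<and>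
           K = - transpose K \<and>
           transpose Q ** E = transpose E ** Q \<and> psd (transpose Q ** E) \<and>
           psd W)"

end

theory Submission
  imports Defs "HOL-Computational_Algebra.Fundamental_Theorem_Algebra"
begin

text \<open>
  The system is port-Hamiltonian as soon as some invertible \<open>Q\<close> satisfies \<open>Q\<^sup>T E = E\<^sup>T Q \<ge> 0\<close> and the
  dissipation inequality \<open>Q x \<bullet> (A x + B u) \<le> u \<bullet> (C x + D u)\<close>. Such a \<open>Q\<close> is found by duality, in the
  manner of Rantzer's proof of the KYP lemma: if there were none, a hyperplane argument would give
  columns \<open>(v, y)\<close>, collected in matrices \<open>V\<close> and \<open>Y\<close>, with \<open>(A V + B Y) V\<^sup>* = E S\<close> for a
  skew-Hermitian \<open>S\<close> and negative total supply \<open>Re tr Y\<^sup>* (C V + D Y)\<close>. These columns can be rotated into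
  directions of three kinds: \<open>v = 0\<close>; \<open>s E v = A v + B y\<close> with \<open>Re s = 0\<close>; and \<open>E v = 0\<close> with
  \<open>A v + B y\<close> in the range of \<open>E\<close>. Each has nonnegative supply, the first because \<open>D + D\<^sup>T \<ge> 0\<close>,
  the other two as limits from the open right half-plane (complete controllability supplies the
  perturbations), a contradiction. The degenerate case of a vertical hyperplane is excluded by
  controllability.

  Nonnegativity of \<open>E\<^sup>T Q\<close> follows by stabilizing the system with unit output feedback, and
  invertibility of \<open>Q\<close> from observability.
\<close>

section \<open>Complex matrices\<close>

text \<open>The unknown is \<open>Q\<close> itself, under the linear constraint that
  \<open>E^T Q\<close> be symmetric, so that a singular \<open>E\<close> does no harm; the matrices
  \<open>E S\<close> with \<open>S\<close> skew-Hermitian form the annihilator of this constraint,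
  which is where the condition on the columns comes from. Several columns occur at once because the
  range of a quadratic map is not convex and separation needs its convex hull; the trace adds up
  their supplies and is invariant under rotation of the columns. Skewness of \<open>S\<close>
  confines the finite frequencies to the imaginary axis. The condition on the columns restricts
  \<open>A v + B y\<close> only where \<open>v\<close> is nonzero: inputs at \<open>v = 0\<close>
  need not belong to any trajectory, and for singular \<open>E\<close> the value of the transfer
  function at infinity need not be \<open>D\<close>. Hence positive realness does not control these
  directions, and \<open>D + D^T\<close> must be nonnegative by assumption. Invertibility of
  \<open>Q\<close> matters because \<open>J - R\<close> has to be \<open>A Q^-1\<close>. Frequencies
  force complex vectors; a real \<open>Q\<close> is recovered at the end as the entrywise real part
  of a complex one.\<close>

definition cip :: "complex^'n \<Rightarrow> complex^'n \<Rightarrow> complex" where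
  "cip x y = (\<Sum>i\<in>UNIV. cnj (x $ i) * y $ i)"

lemma cip_add_left: "cip (x + y) z = cip x z + cip y z"
  and cip_add_right: "cip x (y + z) = cip x y + cip x z"
  and cip_diff_left: "cip (x - y) z = cip x z - cip y z"
  and cip_diff_right: "cip x (y - z) = cip x y - cip x z"
  and cip_minus_left: "cip (- x) z = - cip x z"
  and cip_minus_right: "cip x (- z) = - cip x z"
  and cip_scale_left: "cip (c *s x) z = cnj c * cip x z"
  and cip_scale_right: "cip x (c *s z) = c * cip x z"
  and cip_zero_left [simp]: "cip 0 z = 0"
  and cip_zero_right [simp]: "cip x 0 = 0"
  by (simp_all add: cip_def algebra_simps sum.distrib sum_subtractf sum_negf sum_distrib_left)

lemmas cip_simps = cip_add_left cip_add_right cip_diff_left cip_diff_right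
  cip_minus_left cip_minus_right cip_scale_left cip_scale_right

lemma cip_cnj: "cnj (cip x y) = cip y x"
  by (simp add: cip_def mult.commute)

lemma cip_self: "cip x x = complex_of_real ((norm x)\<^sup>2)"
proof -
  have "(norm x)\<^sup>2 = (\<Sum>i\<in>UNIV. (norm (x $ i))\<^sup>2)"
    by (simp add: norm_vec_def L2_set_def sum_nonneg)
  moreover have "cip x x = (\<Sum>i\<in>UNIV. complex_of_real ((norm (x $ i))\<^sup>2))"
    by (simp add: cip_def complex_norm_square mult.commute del: of_real_power)
  ultimately show ?thesis
    by simp
qed

lemma cip_self_eq_0 [simp]: "cip x x = 0 \<longleftrightarrow> x = 0"
  by (simp add: cip_self)

lemma cip_ctranspose: "cip (M *v x) y = cip x (ctranspose M *v y)"
proof -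
  have "cip (M *v x) y = (\<Sum>i\<in>UNIV. \<Sum>j\<in>UNIV. cnj (M $ i $ j) * cnj (x $ j) * y $ i)"
    by (simp add: cip_def matrix_vector_mult_def sum_distrib_right)
  also have "\<dots> = (\<Sum>j\<in>UNIV. \<Sum>i\<in>UNIV. cnj (M $ i $ j) * cnj (x $ j) * y $ i)"
    by (rule sum.swap)
  also have "\<dots> = cip x (ctranspose M *v y)"
    by (simp add: cip_def matrix_vector_mult_def sum_distrib_left ctranspose_def
        transpose_def map_matrix_def algebra_simps)
  finally show ?thesis .
qed

lemma ctranspose_ctranspose [simp]: "ctranspose (ctranspose M) = M"
  by (simp add: ctranspose_def transpose_def map_matrix_def vec_eq_iff)

lemma cip_ctranspose_left: "cip (ctranspose M *v x) y = cip x (M *v y)"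
  using cip_ctranspose[of "ctranspose M" x y] by simp

lemma ctranspose_nth [simp]: "ctranspose M $ i $ j = cnj (M $ j $ i)"
  by (simp add: ctranspose_def transpose_def map_matrix_def)

lemma ctranspose_mult: "ctranspose (M ** N) = ctranspose N ** ctranspose M"
  by (simp add: vec_eq_iff matrix_matrix_mult_def mult.commute)

lemma ctranspose_diff: "ctranspose (M - N) = ctranspose M - ctranspose N"
  and ctranspose_uminus: "ctranspose (- M) = - ctranspose M"
  and ctranspose_mat [simp]: "ctranspose (mat 1) = mat 1"
  by (simp_all add: vec_eq_iff mat_def)

lemma cip_right_eqI: "(\<And>x. cip x y = cip x z) \<Longrightarrow> y = z"
  by (metis cip_diff_right cip_self_eq_0 eq_iff_diff_eq_0)

section \<open>Polynomials in a matrix, eigenvectors in invariant subspaces, and convergence of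
  powers\<close>

definition shifts :: "complex^'k^'k \<Rightarrow> complex list \<Rightarrow> complex^'k \<Rightarrow> complex^'k" where
  "shifts M ls v = foldr (\<lambda>l x. M *v x - l *s x) ls v"

lemma shifts_Nil [simp]: "shifts M [] v = v"
  and shifts_Cons [simp]: "shifts M (l # ls) v = M *v shifts M ls v - l *s shifts M ls v"
  by (simp_all add: shifts_def)

lemma shifts_commute: "shifts M ls (M *v x - l *s x) = M *v shifts M ls x - l *s shifts M ls x"
  by (induction ls)
    (simp_all add: matrix_vector_mult_diff_distrib vector_scalar_commute
      vec.scale_right_diff_distrib vec.scale_left_commute)

text \<open>The vector \<open>p(M) v\<close>, evaluated by Horner's scheme.\<close>

definition poly_apply :: "complex^'k^'k \<Rightarrow> complex poly \<Rightarrow> complex^'k \<Rightarrow> complex^'k" where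
  "poly_apply M p v = fold_coeffs (\<lambda>a x. a *s v + M *v x) p 0"

lemma poly_apply_0 [simp]: "poly_apply M 0 v = 0"
  by (simp add: poly_apply_def)

lemma poly_apply_pCons [simp]: "poly_apply M (pCons a p) v = a *s v + M *v poly_apply M p v"
  by (cases "p = 0 \<and> a = 0") (auto simp: poly_apply_def)

lemma poly_apply_add: "poly_apply M (p + q) v = poly_apply M p v + poly_apply M q v"
  by (induction p q rule: poly_induct2)
    (simp_all add: matrix_vector_right_distrib vec.scale_left_distrib)

lemma poly_apply_smult: "poly_apply M (smult c p) v = c *s poly_apply M p v"
  by (induction p) (simp_all add: vector_scalar_commute vec.scale_right_distrib)

lemma poly_apply_linear_factor:
  "poly_apply M ([:-l, 1:] * q) v = M *v poly_apply M q v - l *s poly_apply M q v"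
proof -
  have "[:-l, 1:] * q = pCons 0 q + smult (-l) q"
    by simp
  then show ?thesis
    by (simp only: poly_apply_add poly_apply_smult poly_apply_pCons) (simp add: vec_eq_iff)
qed

lemma poly_apply_sum: "poly_apply M (\<Sum>i\<in>I. f i) v = (\<Sum>i\<in>I. poly_apply M (f i) v)"
  by (induction I rule: infinite_finite_induct) (simp_all add: poly_apply_add)

lemma poly_apply_monom: "poly_apply M (monom c i) v = c *s (((*v) M) ^^ i) v"
  by (induction i) (simp_all add: monom_0 monom_Suc vector_scalar_commute)

lemma poly_apply_split:
  assumes "p \<noteq> 0"
  shows "\<exists>c ls. c \<noteq> 0 \<and> (\<forall>v. poly_apply M p v = c *s shifts M ls v)"
  using assms
proof (induction "degree p" arbitrary: p)
  case 0
  then obtain a where "p = [:a:]"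
    by (metis degree_eq_zeroE)
  with 0 have "a \<noteq> 0 \<and> (\<forall>v. poly_apply M p v = a *s shifts M [] v)"
    by simp
  then show ?case
    by blast
next
  case (Suc d)
  then obtain l where "poly p l = 0"
    using fundamental_theorem_of_algebra by (metis constant_degree nat.distinct(1))
  then obtain q where q: "p = [:-l, 1:] * q"
    by (metis poly_eq_0_iff_dvd dvdE)
  with Suc.prems have "q \<noteq> 0"
    by auto
  moreover have "degree p = degree [:-l, 1:] + degree q"
    unfolding q by (rule degree_mult_eq) (use \<open>q \<noteq> 0\<close> in auto)
  then have "d = degree q"
    using Suc.hyps(2) by simp
  ultimately obtain c ls where c: "c \<noteq> 0" "\<And>v. poly_apply M q v = c *s shifts M ls v"
    using Suc.hyps(1) by blast
  have "poly_apply M p v = c *s shifts M (l # ls) v" for v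
    unfolding q poly_apply_linear_factor c(2)
    by (simp add: vector_scalar_commute vec.scale_right_diff_distrib vec.scale_left_commute)
  with c(1) show ?case
    by blast
qed

text \<open>One vector more than the dimension among the iterates of \<open>v\<close> forces a
  linear relation, whose coefficients are those of \<open>p\<close>. Dependence concerns the set of
  iterates, so a coincidence of two of them is treated apart, with a difference of
  monomials.\<close>

lemma ex_annihilating_poly:
  fixes M :: "complex^'k^'k"
  shows "\<exists>p. p \<noteq> 0 \<and> poly_apply M p v = 0"
proof -
  define f where "f i = (((*v) M) ^^ i) v" for i
  let ?I = "{..CARD('k)}"
  show ?thesis
  proof (cases "inj_on f ?I")
    case False
    then obtain i j where ij: "f i = f j" "i \<noteq> j"
      by (auto simp: inj_on_def)
    then have "coeff (monom 1 i + monom (-1) j :: complex poly) i \<noteq> 0"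
      by simp
    then have "(monom 1 i + monom (-1) j :: complex poly) \<noteq> 0"
      by fastforce
    moreover have "poly_apply M (monom 1 i + monom (-1) j) v = 0"
      using ij unfolding poly_apply_add poly_apply_monom f_def by (simp add: vec_eq_iff)
    ultimately show ?thesis by blast
  next
    case True
    then have "card (f ` ?I) = CARD('k) + 1"
      by (simp add: card_image)
    then have "vec.dependent (f ` ?I)"
      using vec.independent_bound_general[of "f ` ?I"] vec.dim_subset_UNIV[of "f ` ?I"]
      unfolding vec_dim_card vec.dimension_def
      by (metis Suc_eq_plus1 not_less_eq_eq vec.dimension_def vec_dim_card vec.dim_UNIV order_trans)
    then obtain u where u: "\<exists>x\<in>f ` ?I. u x \<noteq> 0" "(\<Sum>x\<in>f ` ?I. u x *s x) = 0"
      using vec.dependent_finite[of "f ` ?I"] by auto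
    define p where "p = (\<Sum>i\<in>?I. monom (u (f i)) i)"
    have cf: "coeff p i = u (f i)" if "i \<in> ?I" for i
      using that by (simp add: p_def coeff_sum)
    have "p \<noteq> 0"
      using u(1) cf by fastforce
    moreover have "poly_apply M p v = (\<Sum>i\<in>?I. u (f i) *s f i)"
      by (simp add: p_def poly_apply_sum poly_apply_monom f_def)
    then have "poly_apply M p v = 0"
      using u(2) True by (simp add: sum.reindex)
    ultimately show ?thesis by blast
  qed
qed

lemma ex_shifts_eq_0:
  fixes M :: "complex^'k^'k"
  shows "\<exists>ls. shifts M ls v = 0"
proof -
  obtain p where p: "p \<noteq> 0" "poly_apply M p v = 0"
    using ex_annihilating_poly by blast
  then obtain c ls where "c \<noteq> 0" "poly_apply M p v = c *s shifts M ls v"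
    using poly_apply_split by blast
  with p show ?thesis
    by (metis vec.scale_eq_0_iff)
qed

lemma subspace_shifts:
  assumes "vec.subspace W" and "\<And>x. x \<in> W \<Longrightarrow> M *v x \<in> W" and "v \<in> W"
  shows "shifts M ls v \<in> W"
  using assms(3)
  by (induction ls) (auto intro!: vec.subspace_diff vec.subspace_scale assms(1,2))

text \<open>Some product of factors \<open>M - l\<close> annihilates \<open>v\<close>; the last
  nonzero partial product is an eigenvector, and it has not left the invariant subspace.\<close>

lemma ex_eigenvector_in_subspace:
  fixes M :: "complex^'k^'k"
  assumes W: "vec.subspace W" "\<And>x. x \<in> W \<Longrightarrow> M *v x \<in> W" and v: "v \<in> W" "v \<noteq> 0"
  obtains u l where "u \<in> W" "u \<noteq> 0" "M *v u = l *s u"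
proof -
  obtain ls where "shifts M ls v = 0"
    using ex_shifts_eq_0 by blast
  then have "\<exists>u l. u \<in> W \<and> u \<noteq> 0 \<and> M *v u = l *s u"
  proof (induction ls)
    case Nil
    with v show ?case by simp
  next
    case (Cons l ls)
    show ?case
    proof (cases "shifts M ls v = 0")
      case True
      then show ?thesis by (rule Cons.IH)
    next
      case False
      then show ?thesis
        using Cons.prems subspace_shifts[OF W v(1), of ls] by (metis eq_iff_diff_eq_0 shifts_Cons)
    qed
  qed
  then show ?thesis
    using that by blast
qed

lemma norm_vector_scalar_mult: "norm (c *s x) = norm c * norm x" for c :: complex
  by (simp add: norm_vec_def L2_set_def norm_mult power_mult_distrib real_sqrt_mult
      flip: sum_distrib_left)

lemma affine_recurrence_tendsto_0:
  fixes a :: "nat \<Rightarrow> complex^'k"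
  assumes l: "norm l < 1" and b: "(\<lambda>n. a (Suc n) - l *s a n) \<longlonglongrightarrow> 0"
  shows "a \<longlonglongrightarrow> 0"
proof -
  show ?thesis
  proof (rule LIMSEQ_I)
    fix r :: real
    assume r: "0 < r"
    \<comment> \<open>Chosen so that \<open>r / 2\<close> is the fixed point of the map sending
      \<open>t\<close> to \<open>norm l * t + d\<close>.\<close>
    define d where "d = r / 2 * (1 - norm l)"
    have d: "0 < d"
      using r l by (simp add: d_def)
    obtain N where N: "\<And>n. n \<ge> N \<Longrightarrow> norm (a (Suc n) - l *s a n) < d"
      using LIMSEQ_D[OF b d] by auto
    have bd: "norm (a (N + n)) \<le> norm l ^ n * norm (a N) + r / 2" for n
    proof (induction n)
      case 0
      show ?case using r by simp
    next
      case (Suc n)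
      have "norm (a (N + Suc n)) \<le> norm (a (Suc (N + n)) - l *s a (N + n)) + norm (l *s a (N + n))"
        using norm_triangle_ineq[of "a (Suc (N + n)) - l *s a (N + n)" "l *s a (N + n)"] by simp
      also have "\<dots> \<le> d + norm l * (norm l ^ n * norm (a N) + r / 2)"
        unfolding norm_vector_scalar_mult using less_imp_le[OF N[of "N + n"]] by (intro add_mono mult_left_mono Suc.IH) auto
      also have "\<dots> = norm l ^ Suc n * norm (a N) + r / 2"
        by (simp add: d_def field_simps)
      finally show ?case .
    qed
    have "(\<lambda>n. norm l ^ n * norm (a N)) \<longlonglongrightarrow> 0 * norm (a N)"
      by (intro tendsto_intros LIMSEQ_power_zero) (use l in auto)
    then obtain K where K: "\<And>n. n \<ge> K \<Longrightarrow> norm l ^ n * norm (a N) < r / 2"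
      using LIMSEQ_D[of "\<lambda>n. norm l ^ n * norm (a N)" 0 "r / 2"] r by auto
    show "\<exists>no. \<forall>n\<ge>no. norm (a n - 0) < r"
    proof (intro exI allI impI)
      fix n
      assume "n \<ge> N + K"
      then obtain k where k: "n = N + k" "k \<ge> K"
        by (metis add.assoc le_iff_add le_add1)
      then show "norm (a n - 0) < r"
        using bd[of k] K[of k] by simp
    qed
  qed
qed

text \<open>Replaces the Jordan form: one factor \<open>M - l\<close> is removed at a time. By
  induction the powers applied to \<open>M v - l v\<close> tend to 0, which is an inhomogeneous
  recurrence for the powers applied to \<open>v\<close>; its factor \<open>l\<close> is an
  eigenvalue unless the shorter product already annihilates \<open>v\<close>.\<close>

lemma matrix_power_tendsto_0:
  fixes M :: "complex^'k^'k"
  assumes W: "vec.subspace W" "\<And>x. x \<in> W \<Longrightarrow> M *v x \<in> W"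
    and eig: "\<And>u l. u \<in> W \<Longrightarrow> u \<noteq> 0 \<Longrightarrow> M *v u = l *s u \<Longrightarrow> norm l < 1"
    and v: "v \<in> W"
  shows "(\<lambda>n. (((*v) M) ^^ n) v) \<longlonglongrightarrow> 0"
proof -
  obtain ls where "shifts M ls v = 0"
    using ex_shifts_eq_0 by blast
  then show ?thesis
    using v
  proof (induction ls arbitrary: v)
    case Nil
    then have "(((*v) M) ^^ n) v = 0" for n
      by (induction n) simp_all
    then show ?case by simp
  next
    case (Cons l ls)
    show ?case
    proof (cases "shifts M ls v = 0")
      case True
      then show ?thesis using Cons by blast
    next
      case False
      have "M *v shifts M ls v = l *s shifts M ls v"
        using Cons.prems(1) by simp
      then have l: "norm l < 1"
        using eig[OF subspace_shifts[OF W Cons.prems(2)] False] by blast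
      have pw: "(((*v) M) ^^ n) (x - c *s y) = (((*v) M) ^^ n) x - c *s (((*v) M) ^^ n) y" for n x c y
        by (induction n) (simp_all add: matrix_vector_mult_diff_distrib vector_scalar_commute)
      have "shifts M ls (M *v v - l *s v) = 0"
        using Cons.prems(1) by (simp add: shifts_commute)
      moreover have "M *v v - l *s v \<in> W"
        using Cons.prems(2) W by (intro vec.subspace_diff vec.subspace_scale) auto
      ultimately have "(\<lambda>n. (((*v) M) ^^ n) (M *v v - l *s v)) \<longlonglongrightarrow> 0"
        by (rule Cons.IH)
      then have "(\<lambda>n. (((*v) M) ^^ Suc n) v - l *s (((*v) M) ^^ n) v) \<longlonglongrightarrow> 0"
        by (simp only: pw funpow_Suc_right o_def)
      then show ?thesis
        by (rule affine_recurrence_tendsto_0[OF l])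
    qed
  qed
qed

section \<open>Matrix arithmetic and the spectral theorem for Hermitian matrices\<close>

lemma
  fixes A A' :: "'a::ring_1^'n^'m" and B B' :: "'a^'m^'l"
  shows matrix_diff_ldistrib: "B ** (A - A') = B ** A - B ** A'"
    and matrix_diff_rdistrib: "(B - B') ** A = B ** A - B' ** A"
    and matrix_minus_left: "(- B) ** A = - (B ** A)"
    and matrix_minus_right: "B ** (- A) = - (B ** A)"
  by (simp_all add: vec_eq_iff matrix_matrix_mult_def algebra_simps sum_subtractf sum_negf)

text \<open>Induction on the index set: the orthogonal complement of the eigenvectors found so far
  is invariant under \<open>H\<close> and, as long as an index is left, nonzero, so it contains a
  further eigenvector.\<close>

lemma hermitian_orthonormal_eigenvectors:
  fixes H :: "complex^'k^'k" and I :: "'k set"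
  assumes H: "ctranspose H = H"
  shows "\<exists>f. \<forall>i\<in>I. (\<exists>l. H *v f i = l *s f i) \<and> (\<forall>j\<in>I. cip (f i) (f j) = (if i = j then 1 else 0))"
proof -
  have "finite I" by simp
  then show ?thesis
  proof (induction I)
    case empty
    show ?case by simp
  next
    case (insert a I)
    then obtain f where f: "\<And>i. i \<in> I \<Longrightarrow> \<exists>l. H *v f i = l *s f i"
      "\<And>i j. i \<in> I \<Longrightarrow> j \<in> I \<Longrightarrow> cip (f i) (f j) = (if i = j then 1 else 0)"
      by metis
    define W where "W = {x. \<forall>i\<in>I. cip (f i) x = 0}"
    have W: "vec.subspace W"
      by (auto simp: W_def vec.subspace_def cip_simps)
    have HW: "H *v x \<in> W" if "x \<in> W" for x
    proof -
      have "cip (f i) (H *v x) = 0" if i: "i \<in> I" for i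
      proof -
        obtain l where "H *v f i = l *s f i"
          using f(1)[OF i] by blast
        then have "cip (f i) (H *v x) = cnj l * cip (f i) x"
          by (metis H cip_ctranspose cip_scale_left)
        then show ?thesis
          using \<open>x \<in> W\<close> i by (simp add: W_def)
      qed
      then show ?thesis
        by (simp add: W_def)
    qed
    \<comment> \<open>The kernel of \<open>M\<close> is that complement. Row \<open>a\<close> of
      \<open>M\<close> vanishes, so the kernel is nontrivial.\<close>
    define M :: "complex^'k^'k" where "M = (\<chi> i j. if i \<in> I then cnj (f i $ j) else 0)"
    have "det M = 0"
      by (rule det_zero_row(1)[of a]) (use insert.hyps in \<open>simp add: row_def M_def vec_eq_iff\<close>)
    then have "\<not> invertible M"
      by (simp add: invertible_det_nz)
    then obtain x where x: "M *v x = 0" "x \<noteq> 0"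
      by (metis invertible_left_inverse matrix_left_invertible_ker)
    have "cip (f i) x = (M *v x) $ i" if "i \<in> I" for i
      using that by (simp add: cip_def M_def matrix_vector_mult_def)
    then have "x \<in> W"
      using x by (simp add: W_def)
    then obtain u l where u: "u \<in> W" "u \<noteq> 0" "H *v u = l *s u"
      using ex_eigenvector_in_subspace[OF W HW _ x(2)] by blast
    define w where "w = complex_of_real (1 / norm u) *s u"
    have w: "w \<in> W" "H *v w = l *s w"
      using u W by (auto simp: w_def vec.subspace_scale vector_scalar_commute vec.scale_left_commute)
    have w1: "cip w w = 1"
      using u(2) unfolding w_def cip_scale_left cip_scale_right
      by (simp add: cip_self power2_eq_square)
    have wf: "cip (f i) w = 0" "cip w (f i) = 0" if "i \<in> I" for i
    proof -
      show "cip (f i) w = 0"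
        using w(1) that by (simp add: W_def)
      then show "cip w (f i) = 0"
        by (metis cip_cnj complex_cnj_zero)
    qed
    show ?case
      using f w(2) w1 wf insert.hyps by (intro exI[of _ "f(a := w)"]) auto
  qed
qed

lemma hermitian_diagonalization:
  fixes H :: "complex^'k^'k"
  assumes H: "ctranspose H = H"
  obtains f :: "'k \<Rightarrow> complex^'k" and l where "\<And>i. H *v f i = complex_of_real (l i) *s f i"
    "\<And>i j. cip (f i) (f j) = (if i = j then 1 else 0)"
    "\<And>x. (\<Sum>i\<in>UNIV. cip (f i) x *s f i) = x"
proof -
  obtain f :: "'k \<Rightarrow> complex^'k" where "\<forall>i\<in>UNIV. (\<exists>l. H *v f i = l *s f i) \<and>
      (\<forall>j\<in>UNIV. cip (f i) (f j) = (if i = j then 1 else 0))"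
    using hermitian_orthonormal_eigenvectors[OF H, of UNIV] by (elim exE)
  then have f: "\<And>i. \<exists>l. H *v f i = l *s f i"
    "\<And>i j. cip (f i) (f j) = (if i = j then 1 else 0)"
    by blast+
  have "\<exists>l. H *v f i = complex_of_real l *s f i" for i
  proof -
    obtain l where l: "H *v f i = l *s f i"
      using f(1) by blast
    have "cnj l * cip (f i) (f i) = l * cip (f i) (f i)"
      by (metis H cip_ctranspose cip_scale_left cip_scale_right l)
    then have "cnj l = l"
      using f(2)[of i i] by simp
    then show ?thesis
      using l by (metis complex_is_Real_iff Reals_cnj_iff of_real_Re)
  qed
  then obtain l where "\<And>i. H *v f i = complex_of_real (l i) *s f i"
    by metis
  moreover have "(\<Sum>i\<in>UNIV. cip (f i) x *s f i) = x" for x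
  proof -
    define U :: "complex^'k^'k" where "U = (\<chi> i j. f j $ i)"
    have "ctranspose U ** U = mat 1"
      using f(2) by (simp add: vec_eq_iff matrix_matrix_mult_def U_def mat_def cip_def)
    then have "U ** ctranspose U = mat 1"
      by (simp add: matrix_left_right_inverse)
    then have "x = U *v (ctranspose U *v x)"
      by (simp add: matrix_vector_mul_assoc)
    also have "\<dots> = (\<Sum>i\<in>UNIV. cip (f i) x *s f i)"
      by (simp add: vec_eq_iff matrix_vector_mult_def U_def cip_def mult.commute)
    finally show ?thesis ..
  qed
  ultimately show ?thesis
    using that f(2) by blast
qed

section \<open>Traces and pseudo-inverses\<close>

definition mtrace :: "complex^'k^'k \<Rightarrow> complex" where
  "mtrace T = (\<Sum>i\<in>UNIV. T $ i $ i)"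

lemma cip_axis_left: "cip (axis i 1) x = x $ i"
proof -
  have "cip (axis i 1) x = (\<Sum>j\<in>UNIV. if j = i then x $ j else 0)"
    unfolding cip_def by (rule sum.cong) (auto simp: axis_def)
  then show ?thesis by simp
qed

lemma mtrace_commute: "mtrace (M ** N) = mtrace (N ** M)"
  for M :: "complex^'k^'l" and N :: "complex^'l^'k"
  unfolding mtrace_def matrix_matrix_mult_def
  by (simp add: mult.commute) (rule sum.swap)

lemma mtrace_diff: "mtrace (M - N) = mtrace M - mtrace N"
  by (simp add: mtrace_def sum_subtractf)

lemma mtrace_accretive:
  assumes "\<And>x. 0 \<le> Re (cip x (T *v x))"
  shows "0 \<le> Re (mtrace T)"
proof -
  have "T $ i $ i = cip (axis i 1) (T *v axis i 1)" for i
    unfolding cip_axis_left by (simp add: matrix_vector_mult_def axis_def if_distrib cong: if_cong)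
  then show ?thesis
    using assms by (simp add: mtrace_def sum_nonneg)
qed

lemma mtrace_orthonormal:
  fixes T :: "complex^'k^'k" and f :: "'k \<Rightarrow> complex^'k"
  assumes "\<And>i j. cip (f i) (f j) = (if i = j then 1 else 0)"
  shows "mtrace T = (\<Sum>i\<in>UNIV. cip (f i) (T *v f i))"
proof -
  define U :: "complex^'k^'k" where "U = (\<chi> i j. f j $ i)"
  have "ctranspose U ** U = mat 1"
    using assms by (simp add: vec_eq_iff matrix_matrix_mult_def U_def mat_def cip_def)
  then have "U ** ctranspose U = mat 1"
    by (simp add: matrix_left_right_inverse)
  then have "mtrace T = mtrace (ctranspose U ** (T ** U))"
    by (metis matrix_mul_assoc matrix_mul_rid mtrace_commute)
  also have "\<dots> = (\<Sum>i\<in>UNIV. cip (f i) (T *v f i))"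
    by (simp add: mtrace_def matrix_matrix_mult_def U_def cip_def matrix_vector_mult_def)
  finally show ?thesis .
qed

text \<open>These two Penrose equations make \<open>X ** V\<close> the orthogonal projection with
  the same kernel as \<open>V\<close>. The witness is the adjoint of \<open>V\<close> preceded by
  the inverse of its Gram matrix on the nonzero eigenvalues.\<close>

lemma pseudo_inverse_exists:
  fixes V :: "complex^'k^'n"
  obtains X where "V ** X ** V = V" "ctranspose (X ** V) = X ** V"
proof -
  define H where "H = ctranspose V ** V"
  have H: "ctranspose H = H"
    by (simp add: H_def ctranspose_mult)
  obtain f :: "'k \<Rightarrow> complex^'k" and l where f: "\<And>i. H *v f i = complex_of_real (l i) *s f i"
    "\<And>i j. cip (f i) (f j) = (if i = j then 1 else 0)"
    "\<And>x. (\<Sum>i\<in>UNIV. cip (f i) x *s f i) = x"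
    by (rule hermitian_diagonalization[OF H], rule that)
  \<comment> \<open>Functional calculus: \<open>dg g\<close> is \<open>g\<close> applied to
    \<open>H\<close>.\<close>
  define dg :: "(real \<Rightarrow> real) \<Rightarrow> complex^'k^'k" where
    "dg g = (\<chi> i j. \<Sum>a\<in>UNIV. of_real (g (l a)) * f a $ i * cnj (f a $ j))" for g
  have dg: "dg g *v x = (\<Sum>a\<in>UNIV. (of_real (g (l a)) * cip (f a) x) *s f a)" for g x
  proof -
    have "(dg g *v x) $ i = (\<Sum>a\<in>UNIV. (of_real (g (l a)) * cip (f a) x) *s f a) $ i" for i
    proof -
      have "(dg g *v x) $ i = (\<Sum>j\<in>UNIV. \<Sum>a\<in>UNIV. of_real (g (l a)) * f a $ i * cnj (f a $ j) * x $ j)"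
        by (simp add: dg_def matrix_vector_mult_def sum_distrib_right)
      also have "\<dots> = (\<Sum>a\<in>UNIV. \<Sum>j\<in>UNIV. of_real (g (l a)) * f a $ i * cnj (f a $ j) * x $ j)"
        by (rule sum.swap)
      finally show ?thesis
        by (simp add: cip_def sum_distrib_left sum_distrib_right mult_ac)
    qed
    then show ?thesis
      by (simp add: vec_eq_iff)
  qed
  have cdg: "ctranspose (dg g) = dg g" for g
    by (simp add: vec_eq_iff dg_def mult_ac)
  have dgf: "dg g *v f a = of_real (g (l a)) *s f a" for g a
    unfolding dg f(2) by (simp add: if_distrib[of "\<lambda>c. _ * c"] if_distrib[of "\<lambda>c. c *s _"] cong: if_cong)
  have eqf: "M = N" if "\<And>a. M *v f a = N *v f a" for M N :: "complex^'k^'k"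
  proof -
    have "M *v x = N *v x" for x
      by (subst (1 2) f(3)[symmetric])
        (simp add: vec.linear_sum vector_scalar_commute that del: f(3))
    then show ?thesis
      by (simp add: matrix_eq)
  qed
  define Z where "Z = dg (\<lambda>t. if t = 0 then 0 else 1 / t)"
  define X where "X = Z ** ctranspose V"
  have XV: "X ** V = dg (\<lambda>t. if t = 0 then 0 else 1)"
  proof (rule eqf)
    fix a
    have "X ** V *v f a = Z *v (H *v f a)"
      by (simp add: X_def H_def matrix_vector_mul_assoc matrix_mul_assoc)
    also have "\<dots> = dg (\<lambda>t. if t = 0 then 0 else 1) *v f a"
      unfolding f(1) vector_scalar_commute Z_def dgf by (simp add: vec.scale_scale)
    finally show "X ** V *v f a = dg (\<lambda>t. if t = 0 then 0 else 1) *v f a" .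
  qed
  \<comment> \<open>\<open>L\<close> equals \<open>V ** (X ** V - mat 1)\<close>, and
    \<open>X ** V - mat 1\<close> maps into the kernel of the Gram matrix \<open>H\<close>; hence
    the Gram matrix of \<open>L\<close> vanishes, and so does \<open>L\<close>.\<close>
  define L where "L = V ** X ** V - V"
  have HL: "H ** (X ** V - mat 1) = 0"
  proof (rule eqf)
    fix a
    have "(X ** V - mat 1) *v f a = (if l a = 0 then - f a else 0)"
      unfolding XV matrix_vector_mult_diff_rdistrib dgf by simp
    moreover have "H *v (- f a) = - (of_real (l a) *s f a)"
      using matrix_vector_mult_diff_distrib[of H 0 "f a"] f(1)[of a] by simp
    ultimately show "H ** (X ** V - mat 1) *v f a = 0 *v f a"
      by (simp flip: matrix_vector_mul_assoc)
  qed
  have "ctranspose L ** L = 0"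
  proof -
    have L: "L = V ** (X ** V - mat 1)"
      by (simp add: L_def matrix_mul_assoc matrix_diff_ldistrib)
    have "ctranspose L ** L = ctranspose (X ** V - mat 1) ** (H ** (X ** V - mat 1))"
      unfolding L ctranspose_mult H_def by (simp add: matrix_mul_assoc)
    then show ?thesis
      by (simp add: HL)
  qed
  then have "cip (L *v x) (L *v x) = 0" for x
    by (simp add: cip_ctranspose matrix_vector_mul_assoc)
  then have "L = 0"
    by (simp add: matrix_eq)
  then have "V ** X ** V = V"
    by (simp add: L_def)
  moreover have "ctranspose (X ** V) = X ** V"
    by (simp add: XV cdg)
  ultimately show ?thesis
    by (rule that)
qed

section \<open>Perturbation of trajectories\<close>

lemma tendsto_cip:
  assumes "(f \<longlongrightarrow> a) F" "(g \<longlongrightarrow> b) F"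
  shows "((\<lambda>n. cip (f n) (g n)) \<longlongrightarrow> cip a b) F"
  unfolding cip_def by (intro tendsto_intros tendsto_vec_nth assms)

lemma tendsto_matrix_vector_mult:
  "(f \<longlongrightarrow> a) F \<Longrightarrow> ((\<lambda>n. M *v f n) \<longlongrightarrow> M *v a) F" for M :: "complex^'k^'l"
  by (rule bounded_linear.tendsto[OF matrix_vector_mul_bounded_linear])

lemma tendsto_vector_scalar_mult:
  fixes f :: "'x \<Rightarrow> complex"
  assumes "(f \<longlongrightarrow> a) F" "(g \<longlongrightarrow> b) F"
  shows "((\<lambda>n. f n *s g n) \<longlongrightarrow> a *s b) F"
  by (rule vec_tendstoI) (simp add: tendsto_mult tendsto_vec_nth assms)

text \<open>Once \<open>norm (e n)\<close> is at most \<open>1 / (2 * K)\<close>, with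
  \<open>K\<close> a bound for \<open>N\<close>, the operator \<open>1 + e n N\<close> is bounded
  below by \<open>1 / 2\<close>. So it is invertible and the solution is at most twice as large as
  \<open>u n\<close>.\<close>

lemma near_identity_solvable:
  fixes N :: "complex^'n^'n"
  assumes e: "e \<longlonglongrightarrow> 0" and u: "u \<longlonglongrightarrow> 0"
  obtains w where "w \<longlonglongrightarrow> 0" "\<forall>\<^sub>F n in sequentially. w n + e n *s (N *v w n) = u n"
proof -
  obtain K where K: "0 < K" "\<And>x. norm (N *v x) \<le> norm x * K"
    using bounded_linear.pos_bounded[OF matrix_vector_mul_bounded_linear[of N]] by blast
  have est: "norm w \<le> 2 * norm (w + c *s (N *v w))" if "norm c \<le> 1 / (2 * K)" for c w
  proof -
    have "norm c * norm (N *v w) \<le> 1 / (2 * K) * (norm w * K)"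
      using that K by (intro mult_mono) auto
    then have "norm (c *s (N *v w)) \<le> norm w / 2"
      using K(1) by (simp add: norm_vector_scalar_mult field_simps)
    then show ?thesis
      using norm_triangle_ineq4[of "w + c *s (N *v w)" "c *s (N *v w)"] by simp
  qed
  have ex: "\<exists>w. w + c *s (N *v w) = b" if c: "norm c \<le> 1 / (2 * K)" for c b
  proof -
    define M :: "complex^'n^'n" where "M = mat 1 + (\<chi> i j. c * N $ i $ j)"
    have M: "M *v w = w + c *s (N *v w)" for w
      by (simp add: M_def matrix_vector_mult_add_rdistrib)
        (simp add: vec_eq_iff matrix_vector_mult_def sum_distrib_left mult_ac)
    have "w = 0" if "M *v w = 0" for w
      using est[OF c, of w] that unfolding M by simp
    then obtain M' where "M ** M' = mat 1"
      by (metis matrix_left_invertible_ker matrix_left_right_inverse)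
    then have "M *v (M' *v b) = b"
      by (simp add: matrix_vector_mul_assoc)
    then show ?thesis
      unfolding M by blast
  qed
  have ev: "\<forall>\<^sub>F n in sequentially. norm (e n) \<le> 1 / (2 * K)"
    using order_tendstoD(2)[OF tendsto_norm[OF e], of "1 / (2 * K)"] K(1)
    by (auto elim: eventually_mono)
  define w where "w n = (if norm (e n) \<le> 1 / (2 * K) then SOME w. w + e n *s (N *v w) = u n else 0)"
    for n
  have w: "w n + e n *s (N *v w n) = u n" if "norm (e n) \<le> 1 / (2 * K)" for n
    using someI_ex[OF ex[OF that]] that by (simp add: w_def)
  have "norm (w n) \<le> 2 * norm (u n)" for n
    by (cases "norm (e n) \<le> 1 / (2 * K)") (use est w in \<open>metis\<close>, simp add: w_def)
  then have "w \<longlonglongrightarrow> 0"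
    by (intro Lim_null_comparison[OF _ tendsto_mult_right_zero[OF tendsto_norm_zero[OF u], of 2]])
      auto
  moreover have "\<forall>\<^sub>F n in sequentially. w n + e n *s (N *v w n) = u n"
    using ev by eventually_elim (rule w)
  ultimately show ?thesis
    by (rule that)
qed

lemma real_linear_nonneg_imp_0:
  assumes "\<And>t::real. 0 \<le> a + t * b"
  shows "b = 0"
proof (rule ccontr)
  assume "b \<noteq> 0"
  then show False
    using assms[of "- (a + 1) / b"] by simp
qed

lemma real_quadratic_nonneg_imp_0:
  assumes "\<And>t::real. 0 \<le> t * b + t\<^sup>2 * c"
  shows "b = 0"
proof (rule ccontr)
  assume b: "b \<noteq> 0"
  \<comment> \<open>With \<open>d\<close> larger than \<open>\<bar>c\<bar>\<close>, the choice
    \<open>t = - b / d\<close> lets the linear term outweigh the quadratic one.\<close>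
  define d where "d = \<bar>c\<bar> + 1"
  have d: "0 < d" "\<bar>c\<bar> = d - 1"
    by (auto simp: d_def)
  define t where "t = - b / d"
  have "t * b + t\<^sup>2 * c \<le> t * b + t\<^sup>2 * \<bar>c\<bar>"
    by (simp add: mult_left_mono)
  also have "\<dots> = - (b\<^sup>2 / d\<^sup>2)"
    unfolding d(2) t_def using d(1) by (simp add: power2_eq_square field_simps)
  also have "\<dots> < 0"
    using b d(1) by simp
  finally show False
    using assms[of t] by simp
qed

text \<open>The form is that of the Hermitian part of \<open>M\<close>. A zero of a nonnegative form
  is a minimum, so the derivative vanishes there; the test direction \<open>w\<close> is the
  gradient itself.\<close>

lemma accretive_kernel:
  assumes acc: "\<And>x. 0 \<le> Re (cip x (M *v x))" and x: "Re (cip x (M *v x)) = 0"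
  shows "M *v x + ctranspose M *v x = 0"
proof -
  define w where "w = M *v x + ctranspose M *v x"
  have "0 \<le> t * Re (cip w w) + t\<^sup>2 * Re (cip w (M *v w))" for t :: real
  proof -
    have "cip x (M *v w) = cnj (cip w (ctranspose M *v x))"
      by (simp add: cip_cnj cip_ctranspose_left)
    then have "Re (cip (x + of_real t *s w) (M *v (x + of_real t *s w)))
        = Re (cip x (M *v x)) + t * (Re (cip w (M *v x)) + Re (cip w (ctranspose M *v x)))
          + t\<^sup>2 * Re (cip w (M *v w))"
      by (simp add: matrix_vector_right_distrib vector_scalar_commute cip_simps power2_eq_square
          algebra_simps)
    also have "\<dots> = t * Re (cip w w) + t\<^sup>2 * Re (cip w (M *v w))"
      by (simp add: x w_def cip_add_right)
    finally show ?thesis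
      using acc by metis
  qed
  then have "Re (cip w w) = 0"
    by (rule real_quadratic_nonneg_imp_0)
  then show ?thesis
    by (simp add: cip_self w_def)
qed

text \<open>The hypothesis makes \<open>S\<close>, the Gram matrix of the rows of
  \<open>[M, B]\<close>, invertible; the right inverse is the adjoint of \<open>[M, B]\<close> times
  the inverse of \<open>S\<close>.\<close>

lemma right_inverse_pair:
  fixes M :: "complex^'n^'n" and B :: "complex^'m^'n"
  assumes "\<And>z. ctranspose M *v z = 0 \<Longrightarrow> ctranspose B *v z = 0 \<Longrightarrow> z = 0"
  obtains X Y where "\<And>w. M *v (X *v w) + B *v (Y *v w) = w"
proof -
  define S where "S = M ** ctranspose M + B ** ctranspose B"
  have S: "S *v z = M *v (ctranspose M *v z) + B *v (ctranspose B *v z)" for z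
    by (simp add: S_def matrix_vector_mult_add_rdistrib matrix_vector_mul_assoc)
  have "z = 0" if "S *v z = 0" for z
  proof -
    have "cip z (S *v z) = of_real ((norm (ctranspose M *v z))\<^sup>2 + (norm (ctranspose B *v z))\<^sup>2)"
      by (simp add: S cip_add_right cip_self flip: cip_ctranspose_left)
    then have "(norm (ctranspose M *v z))\<^sup>2 + (norm (ctranspose B *v z))\<^sup>2 = 0"
      unfolding that by (metis cip_zero_right of_real_eq_0_iff)
    then show ?thesis
      using assms by (simp add: sum_power2_eq_zero_iff)
  qed
  then obtain S' where "S ** S' = mat 1"
    by (metis matrix_left_invertible_ker matrix_left_right_inverse)
  then have "S *v (S' *v w) = w" for w
    by (simp add: matrix_vector_mul_assoc)
  then show ?thesis
    unfolding S by (intro that[of "ctranspose M ** S'" "ctranspose B ** S'"])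
      (simp add: matrix_vector_mul_assoc matrix_mul_assoc)
qed

definition cpencil :: "complex^'n^'n \<Rightarrow> complex^'n^'n \<Rightarrow> complex \<Rightarrow> complex \<Rightarrow> complex^'n^'n" where
  "cpencil E A a b = (\<chi> i j. a * E $ i $ j - b * A $ i $ j)"

lemma cpencil_mult: "cpencil E A a b *v x = a *s (E *v x) - b *s (A *v x)"
  by (simp add: cpencil_def vec_eq_iff matrix_vector_mult_def sum_distrib_left sum_subtractf
      algebra_simps)

lemma ctranspose_cpencil:
  "ctranspose (cpencil E A a b) = cpencil (ctranspose E) (ctranspose A) (cnj a) (cnj b)"
  by (simp add: cpencil_def vec_eq_iff)

lemma skew_diagonalization:
  fixes S :: "complex^'k^'k"
  assumes S: "ctranspose S = - S"
  obtains f :: "'k \<Rightarrow> complex^'k" and l where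
    "\<And>i. S *v f i = (\<i> * complex_of_real (l i)) *s f i"
    "\<And>i j. cip (f i) (f j) = (if i = j then 1 else 0)"
proof -
  define H :: "complex^'k^'k" where "H = (\<chi> i j. \<i> * S $ i $ j)"
  have H: "ctranspose H = H"
    using S by (simp add: H_def vec_eq_iff)
  obtain f :: "'k \<Rightarrow> complex^'k" and l where f: "\<And>i. H *v f i = complex_of_real (l i) *s f i"
    "\<And>i j. cip (f i) (f j) = (if i = j then 1 else 0)"
    by (rule hermitian_diagonalization[OF H], rule that)
  have "H *v x = \<i> *s (S *v x)" for x
    by (simp add: H_def vec_eq_iff matrix_vector_mult_def sum_distrib_left mult_ac)
  then have "\<i> *s (S *v f i) = complex_of_real (l i) *s f i" for i
    by (simp flip: f(1))
  then have "(- \<i>) *s (\<i> *s (S *v f i)) = (- \<i>) *s (complex_of_real (l i) *s f i)" for i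
    by simp
  then have "S *v f i = (\<i> * complex_of_real (- l i)) *s f i" for i
    by (simp add: vec.scale_scale)
  then show ?thesis
    using f(2) that[of f "\<lambda>i. - l i"] by blast
qed

text \<open>Full row rank of the pencil bordered by \<open>B\<close>, as triviality of its left
  kernel. The pair \<open>(a, b)\<close> is a projective frequency, with \<open>b = 0\<close> the
  point at infinity; since it ranges over all nonzero pairs, no conjugates are needed.\<close>

locale controllable =
  fixes E A :: "complex^'n^'n" and B :: "complex^'m^'n"
  assumes ctrl: "\<And>a b z. (a, b) \<noteq> (0, 0) \<Longrightarrow>
      a *s (ctranspose E *v z) = b *s (ctranspose A *v z) \<Longrightarrow> ctranspose B *v z = 0 \<Longrightarrow> z = 0"
begin

lemma right_inverse:
  assumes "(a, b) \<noteq> (0, 0)"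
  obtains X Y where
    "\<And>w. a *s (E *v (X *v w)) - b *s (A *v (X *v w)) + B *v (Y *v w) = w"
proof -
  have "z = 0" if "ctranspose (cpencil E A a b) *v z = 0" "ctranspose B *v z = 0" for z
    using ctrl[of "cnj a" "cnj b" z] that assms by (simp add: ctranspose_cpencil cpencil_mult)
  then obtain X Y where "\<And>w. cpencil E A a b *v (X *v w) + B *v (Y *v w) = w"
    using right_inverse_pair[of "cpencil E A a b" B] by metis
  then show ?thesis
    unfolding cpencil_mult by (rule that)
qed

text \<open>Changing the frequency by \<open>e n\<close> leaves the defect
  \<open>e n *s (E *v v)\<close>. The right inverse of \<open>[s E - A, B]\<close> absorbs it up to
  a term of order \<open>e n\<close>, which the equation for \<open>w\<close> accounts for.\<close>

lemma perturb_finite: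
  assumes eq: "s *s (E *v v) = A *v v + B *v y" and e: "e \<longlonglongrightarrow> 0"
  obtains v' y' where "v' \<longlonglongrightarrow> v" "y' \<longlonglongrightarrow> y"
    "\<forall>\<^sub>F n in sequentially. (s + e n) *s (E *v v' n) = A *v v' n + B *v y' n"
proof -
  obtain X Y where XY: "\<And>w. s *s (E *v (X *v w)) - 1 *s (A *v (X *v w)) + B *v (Y *v w) = w"
    using right_inverse[of s 1] by auto
  have "(\<lambda>n. e n *s (E *v v)) \<longlonglongrightarrow> 0 *s (E *v v)"
    by (intro tendsto_vector_scalar_mult e tendsto_const)
  then have "(\<lambda>n. e n *s (E *v v)) \<longlonglongrightarrow> 0"
    by simp
  then obtain w where w: "w \<longlonglongrightarrow> 0"
    "\<forall>\<^sub>F n in sequentially. w n + e n *s ((E ** X) *v w n) = e n *s (E *v v)"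
    using near_identity_solvable[OF e] by blast
  define v' where "v' n = v - X *v w n" for n
  define y' where "y' n = y + Y *v w n" for n
  have "v' \<longlonglongrightarrow> v - X *v 0" "y' \<longlonglongrightarrow> y + Y *v 0"
    unfolding v'_def y'_def by (intro tendsto_intros tendsto_matrix_vector_mult w)+
  moreover have "\<forall>\<^sub>F n in sequentially. (s + e n) *s (E *v v' n) = A *v v' n + B *v y' n"
    using w(2)
  proof eventually_elim
    case (elim n)
    have "(s + e n) *s (E *v v' n) - (A *v v' n + B *v y' n)
      = (s *s (E *v v) - A *v v - B *v y) + e n *s (E *v v)
        - (s *s (E *v (X *v w n)) - 1 *s (A *v (X *v w n)) + B *v (Y *v w n))
        - e n *s (E *v (X *v w n))"
      by (simp add: v'_def y'_def matrix_vector_mult_diff_distrib matrix_vector_right_distrib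
          vec.scale_left_distrib vec.scale_right_diff_distrib)
    also have "\<dots> = 0"
      unfolding XY using elim by (simp add: eq matrix_vector_mul_assoc flip: elim)
    finally show ?case by simp
  qed
  ultimately show ?thesis
    by (intro that) simp_all
qed

text \<open>The approximating frequencies are \<open>1 / e n\<close>. The first-order displacement
  of \<open>v\<close> has to be \<open>v1\<close>, which balances \<open>A *v v + B *v y\<close>;
  the rest is corrected by a right inverse of \<open>[E, B]\<close>.\<close>

lemma perturb_infinite:
  assumes eq: "E *v v = 0" "A *v v + B *v y = E *v v1" and e: "e \<longlonglongrightarrow> 0"
  obtains v' y' where "v' \<longlonglongrightarrow> v" "y' \<longlonglongrightarrow> y"
    "\<forall>\<^sub>F n in sequentially. E *v v' n = e n *s (A *v v' n + B *v y' n)"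
proof -
  obtain X Y where XY: "\<And>w. 1 *s (E *v (X *v w)) - 0 *s (A *v (X *v w)) + B *v (Y *v w) = w"
    using right_inverse[of 1 0] by auto
  have e': "(\<lambda>n. - e n) \<longlonglongrightarrow> 0"
    using tendsto_minus[OF e] by simp
  have "(\<lambda>n. e n *s (A *v v1)) \<longlonglongrightarrow> 0 *s (A *v v1)"
    by (intro tendsto_vector_scalar_mult e tendsto_const)
  then have "(\<lambda>n. e n *s (A *v v1)) \<longlonglongrightarrow> 0"
    by simp
  then obtain w where w: "w \<longlonglongrightarrow> 0"
    "\<forall>\<^sub>F n in sequentially. w n + (- e n) *s ((A ** X) *v w n) = e n *s (A *v v1)"
    using near_identity_solvable[OF e'] by blast
  define v' where "v' n = v + e n *s (v1 + X *v w n)" for n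
  define y' where "y' n = y - Y *v w n" for n
  have "v' \<longlonglongrightarrow> v + 0 *s (v1 + X *v 0)" "y' \<longlonglongrightarrow> y - Y *v 0"
    unfolding v'_def y'_def
    by (intro tendsto_intros tendsto_matrix_vector_mult tendsto_vector_scalar_mult w e)+
  moreover have "\<forall>\<^sub>F n in sequentially. E *v v' n = e n *s (A *v v' n + B *v y' n)"
    using w(2)
  proof eventually_elim
    case (elim n)
    have "E *v v' n - e n *s (A *v v' n + B *v y' n)
      = E *v v + e n *s (E *v v1 - (A *v v + B *v y))
        + e n *s (1 *s (E *v (X *v w n)) - 0 *s (A *v (X *v w n)) + B *v (Y *v w n))
        - e n *s (e n *s (A *v v1)) - e n *s (e n *s (A *v (X *v w n)))"
      by (simp add: v'_def y'_def matrix_vector_mult_diff_distrib matrix_vector_right_distrib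
          vector_scalar_commute
          vec.scale_left_distrib vec.scale_right_diff_distrib vec.scale_right_distrib)
    also have "\<dots> = e n *s (w n + (- e n) *s ((A ** X) *v w n) - e n *s (A *v v1))"
      unfolding XY by (simp add: eq matrix_vector_mul_assoc
          vec.scale_left_distrib vec.scale_right_diff_distrib vec.scale_right_distrib)
    also have "\<dots> = 0"
      by (simp only: elim) simp
    finally show ?case by simp
  qed
  ultimately show ?thesis
    by (intro that) simp_all
qed

end

section \<open>Nonnegative supply\<close>

text \<open>\<open>positive\<close> and \<open>stable\<close> are what positive realness amounts to under complete controllability
  and observability.\<close>

locale positive_real_system = controllable E A B
  for E A :: "complex^'n^'n" and B :: "complex^'m^'n" +
  fixes C :: "complex^'n^'m" and D :: "complex^'m^'m"
  assumes obs: "\<And>a b v. (a, b) \<noteq> (0, 0) \<Longrightarrow> a *s (E *v v) = b *s (A *v v) \<Longrightarrow> C *v v = 0 \<Longrightarrow> v = 0"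
    and stable: "\<And>s v. 0 < Re s \<Longrightarrow> s *s (E *v v) = A *v v \<Longrightarrow> v = 0"
    and positive: "\<And>s v y. 0 < Re s \<Longrightarrow> s *s (E *v v) = A *v v + B *v y \<Longrightarrow>
        0 \<le> Re (cip y (C *v v + D *v y))"
    and D_accretive: "\<And>y. 0 \<le> Re (cip y (D *v y))"
    and imaginary_regular: "\<exists>s. Re s = 0 \<and> (\<forall>v. s *s (E *v v) = A *v v \<longrightarrow> v = 0)"
begin

lemma supply_limit:
  assumes "v' \<longlonglongrightarrow> v" "y' \<longlonglongrightarrow> y"
    and "\<forall>\<^sub>F n in sequentially. 0 \<le> Re (cip (y' n) (C *v v' n + D *v y' n))"
  shows "0 \<le> Re (cip y (C *v v + D *v y))"
proof (rule tendsto_lowerbound)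
  show "(\<lambda>n. Re (cip (y' n) (C *v v' n + D *v y' n))) \<longlonglongrightarrow> Re (cip y (C *v v + D *v y))"
    by (intro tendsto_Re tendsto_cip tendsto_add tendsto_matrix_vector_mult assms)
qed (use assms in auto)

lemma positive_closed_half_plane:
  assumes s: "0 \<le> Re s" and eq: "s *s (E *v v) = A *v v + B *v y"
  shows "0 \<le> Re (cip y (C *v v + D *v y))"
proof -
  define e where "e n = complex_of_real (inverse (real (Suc n)))" for n
  have "(\<lambda>n. complex_of_real (inverse (real (Suc n)))) \<longlonglongrightarrow> complex_of_real 0"
    by (intro tendsto_of_real LIMSEQ_inverse_real_of_nat)
  then have e: "e \<longlonglongrightarrow> 0"
    unfolding e_def by simp
  obtain v' y' where v': "v' \<longlonglongrightarrow> v" "y' \<longlonglongrightarrow> y"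
    "\<forall>\<^sub>F n in sequentially. (s + e n) *s (E *v v' n)
      = A *v v' n + B *v y' n"
    by (rule perturb_finite[OF eq e])
  have pos: "0 < Re (s + e n)" for n
    using s by (simp add: e_def add_nonneg_pos)
  from v'(3) have "\<forall>\<^sub>F n in sequentially. 0 \<le> Re (cip (y' n) (C *v v' n + D *v y' n))"
    by eventually_elim (rule positive[OF pos])
  then show ?thesis
    by (rule supply_limit[OF v'(1,2)])
qed

lemma positive_at_infinity:
  assumes eq: "E *v v = 0" "A *v v + B *v y = E *v v1"
  shows "0 \<le> Re (cip y (C *v v + D *v y))"
proof -
  define e where "e n = complex_of_real (inverse (real (Suc n)))" for n
  have "(\<lambda>n. complex_of_real (inverse (real (Suc n)))) \<longlonglongrightarrow> complex_of_real 0"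
    by (intro tendsto_of_real LIMSEQ_inverse_real_of_nat)
  then have e: "e \<longlonglongrightarrow> 0"
    unfolding e_def by simp
  obtain v' y' where v': "v' \<longlonglongrightarrow> v" "y' \<longlonglongrightarrow> y"
    "\<forall>\<^sub>F n in sequentially. E *v v' n = e n *s (A *v v' n + B *v y' n)"
    by (rule perturb_infinite[OF eq e])
  from v'(3) have "\<forall>\<^sub>F n in sequentially. 0 \<le> Re (cip (y' n) (C *v v' n + D *v y' n))"
  proof eventually_elim
    case (elim n)
    have "complex_of_real (real (Suc n)) *s (E *v v' n) = A *v v' n + B *v y' n"
      unfolding elim by (simp add: e_def vec.scale_scale del: of_nat_Suc)
    then show ?case
      by (intro positive[of "complex_of_real (real (Suc n))"]) auto
  qed
  then show ?thesis
    by (rule supply_limit[OF v'(1,2)])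
qed

text \<open>The orthogonal projections \<open>1 - X V\<close>, \<open>X V - X' G\<close> and \<open>X' G\<close> of the column space split the
  sum into the three kinds of directions for which nonnegativity is known: \<open>V = 0\<close>, frequency
  infinity, and (after diagonalizing the skew-Hermitian matrix \<open>W\<close>) finite imaginary
  frequencies.\<close>

lemma mtrace_supply_nonneg:
  fixes V :: "complex^'k^'n" and Y :: "complex^'k^'m"
  assumes F: "(A ** V + B ** Y) ** ctranspose V = E ** S" and S: "ctranspose S = - S"
  shows "0 \<le> Re (mtrace (ctranspose Y ** (C ** V + D ** Y)))"
proof -
  define T where "T = ctranspose Y ** (C ** V + D ** Y)"
  define F where "F = A ** V + B ** Y"
  define G where "G = E ** V"
  have T: "cip u (T *v u) = cip (Y *v u) (C *v (V *v u) + D *v (Y *v u))" for u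
    by (simp add: T_def matrix_vector_mult_add_rdistrib flip: cip_ctranspose matrix_vector_mul_assoc)
  have Fv: "F *v u = A *v (V *v u) + B *v (Y *v u)" for u
    by (simp add: F_def matrix_vector_mult_add_rdistrib flip: matrix_vector_mul_assoc)
  obtain X where X: "V ** X ** V = V" "ctranspose (X ** V) = X ** V"
    by (rule pseudo_inverse_exists)
  obtain X' where X': "G ** X' ** G = G" "ctranspose (X' ** G) = X' ** G"
    by (rule pseudo_inverse_exists)
  define Pv where "Pv = X ** V"
  define Pg where "Pg = X' ** G"
  have Pv: "V ** Pv = V" "ctranspose Pv = Pv" "Pv ** Pv = Pv"
    using X by (simp_all add: Pv_def matrix_mul_assoc) (metis matrix_mul_assoc)
  have Pg: "G ** Pg = G" "ctranspose Pg = Pg" "Pg ** Pg = Pg"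
    using X' by (simp_all add: Pg_def matrix_mul_assoc) (metis matrix_mul_assoc)
  \<comment> \<open>\<open>G = E ** V\<close> vanishes wherever \<open>V\<close> does, so the two
    projections are nested and their difference is again a projection.\<close>
  have PgPv: "Pg ** Pv = Pg"
    using Pv(1) by (metis Pg_def G_def matrix_mul_assoc)
  then have PvPg: "Pv ** Pg = Pg"
    by (metis Pg(2) Pv(2) ctranspose_mult)
  have Pv': "Pv = ctranspose V ** ctranspose X"
    using Pv(2) by (metis Pv_def ctranspose_mult)
  have Pg': "Pg = ctranspose G ** ctranspose X'"
    using Pg(2) by (metis Pg_def ctranspose_mult)
  have FV: "F ** ctranspose V = E ** S"
    using F by (simp add: F_def)
  \<comment> \<open>Cyclicity of the trace replaces \<open>T ** P\<close> by the compression of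
    \<open>T\<close> to the range of \<open>P\<close>, so that only vectors in that range
    matter.\<close>
  have tr: "mtrace (T ** P) = mtrace (P ** T ** P)" if "P ** P = P" for P
    by (metis matrix_mul_assoc mtrace_commute that)
  have cip_proj: "cip x (P ** T ** P *v x) = cip (P *v x) (T *v (P *v x))"
    if "ctranspose P = P" for P x
    by (metis cip_ctranspose matrix_vector_mul_assoc that)
  have 1: "0 \<le> Re (mtrace (T ** (mat 1 - Pv)))"
  proof -
    let ?P = "mat 1 - Pv"
    have P: "?P ** ?P = ?P" "ctranspose ?P = ?P"
      by (simp_all add: matrix_diff_ldistrib matrix_diff_rdistrib Pv ctranspose_diff)
    have "V *v (?P *v x) = 0" for x
      by (simp add: matrix_vector_mul_assoc matrix_diff_ldistrib Pv)
    then have "0 \<le> Re (cip x (?P ** T ** ?P *v x))" for x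
      unfolding cip_proj[OF P(2)] T by (simp add: D_accretive)
    then show ?thesis
      unfolding tr[OF P(1)] by (rule mtrace_accretive)
  qed
  have 2: "0 \<le> Re (mtrace (T ** (Pv - Pg)))"
  proof -
    let ?P = "Pv - Pg"
    have P: "?P ** ?P = ?P" "ctranspose ?P = ?P"
      by (simp_all add: matrix_diff_ldistrib matrix_diff_rdistrib Pv Pg PvPg PgPv ctranspose_diff)
    have "G ** Pv = G"
      by (metis G_def Pv(1) matrix_mul_assoc)
    then have "G *v (?P *v x) = 0" for x
      by (simp add: matrix_vector_mul_assoc matrix_diff_ldistrib Pg)
    then have E0: "E *v (V *v (?P *v x)) = 0" for x
      by (simp add: G_def matrix_vector_mul_assoc matrix_mul_assoc)
    \<comment> \<open>The projection \<open>Pv\<close> has the adjoint of \<open>V\<close> as its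
      left factor, so the hypothesis on \<open>F\<close> applies and exhibits \<open>F\<close> on
      this range as \<open>E\<close> times something: the vector \<open>v1\<close> required at
      frequency infinity.\<close>
    have "F ** ?P = F ** (Pv ** ?P)"
      by (simp add: matrix_diff_ldistrib Pv PvPg)
    also have "\<dots> = E ** (S ** ctranspose X ** ?P)"
      by (metis Pv' FV matrix_mul_assoc)
    finally have "F *v (?P *v x) = E *v (S ** ctranspose X ** ?P *v x)" for x
      by (metis matrix_vector_mul_assoc)
    then have "0 \<le> Re (cip x (?P ** T ** ?P *v x))" for x
      unfolding cip_proj[OF P(2)] T Fv by (rule positive_at_infinity[OF E0])
    then show ?thesis
      unfolding tr[OF P(1)] by (rule mtrace_accretive)
  qed
  have 3: "0 \<le> Re (mtrace (T ** Pg))"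
  proof -
    define Z where "Z = F ** ctranspose G"
    have Z: "Z = E ** S ** ctranspose E"
      by (simp add: Z_def G_def ctranspose_mult matrix_mul_assoc FV)
    have Zs: "ctranspose Z = - Z"
      by (simp add: Z ctranspose_mult S matrix_minus_left matrix_minus_right matrix_mul_assoc)
    \<comment> \<open>\<open>W\<close> represents \<open>F\<close> relative to \<open>G\<close> on
      the range of \<open>Pg\<close>, where \<open>F = G ** W\<close>: an eigenvector of
      \<open>W\<close> there is a pure frequency. It inherits skewness from \<open>Z\<close>, so
      these frequencies are imaginary.\<close>
    define W where "W = X' ** Z ** ctranspose X'"
    have Ws: "ctranspose W = - W"
      by (simp add: W_def ctranspose_mult Zs matrix_minus_left matrix_minus_right matrix_mul_assoc)
    have FPg: "F ** Pg = Z ** ctranspose X'"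
      by (simp add: Pg' Z_def matrix_mul_assoc)
    have "Z = - (G ** ctranspose F)"
      using Zs by (metis Z_def ctranspose_ctranspose ctranspose_mult minus_minus)
    then have "G ** X' ** Z = Z"
      using X'(1) by (metis matrix_minus_right matrix_mul_assoc)
    then have FPgW: "F ** Pg = G ** W"
      by (simp add: FPg W_def matrix_mul_assoc)
    have "W ** Pg = W"
    proof -
      have "W = X' ** (F ** Pg)"
        by (simp add: FPg W_def matrix_mul_assoc)
      then show ?thesis
        by (metis Pg(3) matrix_mul_assoc)
    qed
    moreover from this have "Pg ** W = W"
      by (metis Pg(2) Ws ctranspose_ctranspose ctranspose_mult ctranspose_uminus minus_minus
          matrix_minus_left matrix_minus_right)
    ultimately have comm: "Pg ** W = W ** Pg"
      by simp
    obtain f :: "'k \<Rightarrow> complex^'k" and l where f: "\<And>i. W *v f i = (\<i> * complex_of_real (l i)) *s f i"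
      "\<And>i j. cip (f i) (f j) = (if i = j then 1 else 0)"
      by (rule skew_diagonalization[OF Ws], rule that)
    \<comment> \<open>Since \<open>W\<close> commutes with \<open>Pg\<close>, the projection of
      \<open>f i\<close> is still in the eigenspace, hence a trajectory of frequency
      \<open>\<i> * l i\<close>.\<close>
    have "0 \<le> Re (cip (f i) (Pg ** T ** Pg *v f i))" for i
    proof -
      define u where "u = Pg *v f i"
      have "W *v u = (\<i> * of_real (l i)) *s u"
        unfolding u_def by (metis comm f(1) matrix_vector_mul_assoc vector_scalar_commute)
      moreover have "F *v u = G *v (W *v u)"
        by (metis FPgW Pg(3) u_def matrix_vector_mul_assoc)
      ultimately have "A *v (V *v u) + B *v (Y *v u) = (\<i> * of_real (l i)) *s (E *v (V *v u))"
        by (simp add: Fv G_def vector_scalar_commute matrix_vector_mul_assoc)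
      then show ?thesis
        unfolding cip_proj[OF Pg(2)] u_def[symmetric] T
        by (intro positive_closed_half_plane[of "\<i> * of_real (l i)"]) auto
    qed
    then have "0 \<le> Re (mtrace (Pg ** T ** Pg))"
      unfolding mtrace_orthonormal[of f, OF f(2)] by (simp add: sum_nonneg)
    then show ?thesis
      unfolding tr[OF Pg(3)] .
  qed
  have "mtrace T = mtrace (T ** (mat 1 - Pv)) + mtrace (T ** (Pv - Pg)) + mtrace (T ** Pg)"
    by (simp add: matrix_diff_ldistrib mtrace_diff)
  then show ?thesis
    using 1 2 3 by (simp add: T_def)
qed

end

section \<open>Solvability of the dissipation inequality\<close>

text \<open>The rank-one matrix whose real inner product with \<open>Q\<close> is
  \<open>Re (cip (Q *v v) f)\<close>: the dissipation inequality becomes linear in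
  \<open>Q\<close>.\<close>

definition outer :: "complex^'l \<Rightarrow> complex^'k \<Rightarrow> complex^'k^'l" where
  "outer f v = (\<chi> i j. f $ i * cnj (v $ j))"

lemma inner_outer: "inner Q (outer f v) = Re (cip (Q *v v) f)"
proof -
  have "cip (Q *v v) f = (\<Sum>i\<in>UNIV. \<Sum>j\<in>UNIV. cnj (Q $ i $ j) * (f $ i * cnj (v $ j)))"
    by (simp add: cip_def matrix_vector_mult_def sum_distrib_left sum_distrib_right mult_ac)
  then show ?thesis
    by (simp add: inner_vec_def outer_def inner_complex_def)
qed

lemma scaleR_eq_vector_scalar_mult: "t *\<^sub>R x = complex_of_real t *s x"
  by (simp add: vec_eq_iff complex_eq_iff)

lemma outer_scaleR: "outer (t *\<^sub>R f) (t *\<^sub>R v) = t\<^sup>2 *\<^sub>R outer f v"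
  by (simp add: outer_def vec_eq_iff power2_eq_square)

lemma matrix_vector_mult_scaleR_right: "M *v (t *\<^sub>R x) = t *\<^sub>R (M *v x)"
  for M :: "complex^'k^'l"
  by (rule linear_cmul) simp

lemma cip_scaleR: "cip (t *\<^sub>R x) (t *\<^sub>R y) = (complex_of_real (t\<^sup>2)) * cip x y"
  by (simp add: scaleR_eq_vector_scalar_mult cip_simps power2_eq_square)

lemma inner_matrix_eq_mtrace: "inner M N = Re (mtrace (ctranspose M ** N))"
  for M N :: "complex^'k^'l"
proof -
  have "inner M N = (\<Sum>i\<in>UNIV. \<Sum>j\<in>UNIV. Re (cnj (M $ i $ j) * N $ i $ j))"
    by (simp add: inner_vec_def inner_complex_def)
  also have "\<dots> = (\<Sum>j\<in>UNIV. \<Sum>i\<in>UNIV. Re (cnj (M $ i $ j) * N $ i $ j))"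
    by (rule sum.swap)
  finally show ?thesis
    by (simp add: mtrace_def matrix_matrix_mult_def)
qed

text \<open>Tested against the skew part of \<open>H\<close> itself.\<close>

lemma hermitian_if_orthogonal_skew:
  fixes H :: "complex^'k^'k"
  assumes "\<And>S. ctranspose S = - S \<Longrightarrow> inner H S = 0"
  shows "ctranspose H = H"
proof -
  define S where "S = H - ctranspose H"
  have S: "ctranspose S = - S"
    by (simp add: S_def ctranspose_diff)
  have "inner (ctranspose M) (ctranspose N) = inner M N" for M N :: "complex^'k^'k"
    unfolding inner_vec_def by (subst sum.swap) (simp add: inner_complex_def)
  then have "inner (ctranspose H) S = inner H (ctranspose S)"
    by (metis ctranspose_ctranspose)
  then have "inner (ctranspose H) S = 0"
    using assms[OF S] by (simp add: S)
  then have "inner (H - ctranspose H) S = 0"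
    using assms[OF S] by (simp only: inner_diff_left)
  then have "S = 0"
    by (simp flip: S_def)
  then show ?thesis
    by (simp add: S_def)
qed

section \<open>Excluding the vertical hyperplane\<close>

context positive_real_system
begin

text \<open>Linearity in \<open>y\<close> makes the adjoint of \<open>B\<close> annihilate
  \<open>Q v\<close>. Then \<open>Q\<close> kills every state reached from an input at a regular
  imaginary frequency, and controllability leaves no nonzero vector orthogonal to the states reached
  near \<open>s\<close>.\<close>

lemma multiplier_eq_0:
  assumes herm: "ctranspose Q ** E = ctranspose E ** Q"
    and nonneg: "\<And>v y. 0 \<le> Re (cip (Q *v v) (A *v v + B *v y))"
  shows "Q = 0"
proof -
  have BQ: "ctranspose B *v (Q *v v) = 0" for v
  proof -
    define y where "y = ctranspose B *v (Q *v v)"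
    have "0 \<le> Re (cip (Q *v v) (A *v v)) + t * Re (cip y y)" for t :: real
      using nonneg[of v "complex_of_real t *s y"]
      by (simp add: cip_simps vector_scalar_commute y_def cip_ctranspose_left)
    then have "Re (cip y y) = 0"
      by (rule real_linear_nonneg_imp_0)
    then show ?thesis
      by (simp add: cip_self y_def)
  qed
  have QB: "ctranspose Q *v (B *v y) = 0" for y
  proof (rule cip_right_eqI)
    fix x
    have "cip x (ctranspose Q *v (B *v y)) = cip (ctranspose B *v (Q *v x)) y"
      by (simp add: cip_ctranspose_left flip: cip_ctranspose)
    then show "cip x (ctranspose Q *v (B *v y)) = cip x 0"
      by (simp add: BQ)
  qed
  have QE: "ctranspose Q *v (E *v v) = ctranspose E *v (Q *v v)" for v
    by (simp add: matrix_vector_mul_assoc herm)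
  \<comment> \<open>At an imaginary frequency the nonnegative form
    \<open>Re (cip (Q *v v) (A *v v))\<close> vanishes, since
    \<open>cip v (ctranspose Q *v (E *v v))\<close> is real and \<open>B\<close> does not
    contribute; so \<open>v\<close> lies in the kernel of its Hermitian part.\<close>
  have axis: "ctranspose A *v (Q *v v) + s *s (ctranspose E *v (Q *v v)) = 0"
    if s: "Re s = 0" and eq: "s *s (E *v v) = A *v v + B *v y" for s v y
  proof -
    have "cnj (cip v (ctranspose Q *v (E *v v))) = cip v (ctranspose Q *v (E *v v))"
      unfolding cip_cnj by (metis QE cip_ctranspose_left cip_ctranspose)
    then have im: "Im (cip v (ctranspose Q *v (E *v v))) = 0"
      by (metis Reals_cnj_iff complex_is_Real_iff)
    have Av: "A *v v = s *s (E *v v) - B *v y"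
      by (simp add: eq)
    have QAv: "ctranspose Q *v (A *v v) = s *s (ctranspose E *v (Q *v v))"
      unfolding Av by (simp add: matrix_vector_mult_diff_distrib vector_scalar_commute QB QE)
    have "(ctranspose Q ** A) *v v + ctranspose (ctranspose Q ** A) *v v = 0"
    proof (rule accretive_kernel)
      show "0 \<le> Re (cip x (ctranspose Q ** A *v x))" for x
        using nonneg[of x 0] by (simp add: cip_ctranspose flip: matrix_vector_mul_assoc)
      show "Re (cip v (ctranspose Q ** A *v v)) = 0"
        using im s by (simp add: QAv cip_simps QE flip: matrix_vector_mul_assoc)
    qed
    then show ?thesis
      by (simp add: ctranspose_mult QAv add.commute flip: matrix_vector_mul_assoc)
  qed
  obtain s where s: "Re s = 0" and s_reg: "\<And>v. s *s (E *v v) = A *v v \<Longrightarrow> v = 0"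
    using imaginary_regular by blast
  define M where "M = cpencil E A s 1"
  have M: "M *v v = s *s (E *v v) - A *v v" for v
    by (simp add: M_def cpencil_mult)
  have "v = 0" if "M *v v = 0" for v
    using s_reg that by (simp add: M)
  then obtain Mi where Mi: "Mi ** M = mat 1" "M ** Mi = mat 1"
    by (metis matrix_left_invertible_ker matrix_left_right_inverse)
  have Mi': "M *v (Mi *v x) = x" "Mi *v (M *v x) = x" for x
    by (simp_all add: matrix_vector_mul_assoc Mi)
  have MiH: "ctranspose M *v (ctranspose Mi *v x) = x" "ctranspose Mi *v (ctranspose M *v x) = x" for x
    by (simp_all add: matrix_vector_mul_assoc Mi flip: ctranspose_mult)
  define N where "N = Mi ** E"
  define e where "e n = \<i> * complex_of_real (inverse (real (Suc n)))" for n
  have e_nz: "e n \<noteq> 0" for n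
    by (simp add: e_def del: of_nat_Suc)
  have "(\<lambda>n. \<i> * complex_of_real (inverse (real (Suc n)))) \<longlonglongrightarrow> \<i> * complex_of_real 0"
    by (intro tendsto_mult tendsto_const tendsto_of_real LIMSEQ_inverse_real_of_nat)
  then have e: "e \<longlonglongrightarrow> 0"
    by (simp add: e_def[abs_def])
  \<comment> \<open>The displayed equation means \<open>(s + e n) E v = A v + B y\<close>, so
    \<open>W\<close> consists of the vectors orthogonal to all states reached at the frequencies
    \<open>s + e n\<close>. Only large \<open>n\<close> count, because only then is
    \<open>s + e n\<close> known to avoid the spectrum.\<close>
  define W where "W = {h. \<forall>\<^sub>F n in sequentially. \<forall>v y.
      v + e n *s (N *v v) = Mi *v (B *v y) \<longrightarrow> cip h v = 0}"
  \<comment> \<open>For fixed \<open>y\<close> the states at frequency \<open>s + e n\<close> tend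
    to the state at \<open>s\<close>.\<close>
  have W_b: "cip h (Mi *v (B *v y)) = 0" if h: "h \<in> W" for h y
  proof -
    let ?b = "Mi *v (B *v y)"
    have "(\<lambda>n. e n *s (- (N *v ?b))) \<longlonglongrightarrow> 0 *s (- (N *v ?b))"
      by (intro tendsto_vector_scalar_mult e tendsto_const)
    then obtain w where w: "w \<longlonglongrightarrow> 0"
      "\<forall>\<^sub>F n in sequentially. w n + e n *s (N *v w n) = e n *s (- (N *v ?b))"
      using near_identity_solvable[OF e, of "\<lambda>n. e n *s (- (N *v ?b))" N] by auto
    have "\<forall>\<^sub>F n in sequentially. cip h (?b + w n) = 0"
      using w(2) h[unfolded W_def mem_Collect_eq]
    proof eventually_elim
      case (elim n)
      have "(?b + w n) + e n *s (N *v (?b + w n)) = ?b + e n *s (N *v ?b) + (w n + e n *s (N *v w n))"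
        by (simp add: matrix_vector_right_distrib vec.scale_right_distrib)
      also have "\<dots> = ?b"
        unfolding elim(1) by (simp add: vec.scale_minus_right)
      finally show ?case
        using elim(2) by blast
    qed
    moreover have "(\<lambda>n. cip h (?b + w n)) \<longlonglongrightarrow> cip h (?b + 0)"
      by (intro tendsto_cip tendsto_intros w)
    ultimately have "(\<lambda>n. 0) \<longlonglongrightarrow> cip h (?b + 0)"
      by (rule Lim_transform_eventually[rotated])
    then show ?thesis
      by (simp add: LIMSEQ_const_iff)
  qed
  have W: "vec.subspace W"
    unfolding vec.subspace_def
  proof (intro conjI ballI allI)
    show "0 \<in> W"
      by (simp add: W_def)
    show "x + z \<in> W" if "x \<in> W" "z \<in> W" for x z
      using that unfolding W_def mem_Collect_eq
      by eventually_elim (auto simp: cip_simps)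
    show "c *s x \<in> W" if "x \<in> W" for c x
      using that unfolding W_def mem_Collect_eq
      by eventually_elim (auto simp: cip_simps)
  qed
  have NW: "ctranspose N *v h \<in> W" if h: "h \<in> W" for h
    using h[unfolded W_def mem_Collect_eq] unfolding W_def mem_Collect_eq
  proof eventually_elim
    case (elim n)
    show ?case
    proof (intro allI impI)
      fix v y
      assume v: "v + e n *s (N *v v) = Mi *v (B *v y)"
      then have "cip h v + e n * cip h (N *v v) = 0"
        using W_b[OF h, of y] by (metis cip_add_right cip_scale_right)
      moreover have "cip h v = 0"
        using elim v by blast
      ultimately show "cip (ctranspose N *v h) v = 0"
        using e_nz[of n] by (simp add: cip_ctranspose_left)
    qed
  qed
  \<comment> \<open>An eigenvector of the adjoint of \<open>N\<close> in \<open>W\<close> yields a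
    left null vector of the pencil that \<open>B\<close> does not see, at the projective frequency
    \<open>(1 - l * cnj s, - l)\<close>; eigenvalue 0 corresponds to infinity.\<close>
  have W0: "h = 0" if h: "h \<in> W" for h
  proof (rule ccontr)
    assume "h \<noteq> 0"
    then obtain u l where u: "u \<in> W" "u \<noteq> 0" "ctranspose N *v u = l *s u"
      using ex_eigenvector_in_subspace[OF W NW h] by blast
    define z where "z = ctranspose Mi *v u"
    have uz: "u = cnj s *s (ctranspose E *v z) - ctranspose A *v z"
      using MiH(1)[of u] by (simp add: z_def M_def ctranspose_cpencil cpencil_mult)
    have "ctranspose E *v z = l *s u"
      using u(3) by (simp add: z_def N_def ctranspose_mult flip: matrix_vector_mul_assoc)
    then have "(1 - l * cnj s) *s (ctranspose E *v z) - (- l) *s (ctranspose A *v z)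
        = l *s u - l *s (cnj s *s (ctranspose E *v z) - ctranspose A *v z)"
      by (simp add: vec_eq_iff algebra_simps)
    also have "\<dots> = 0"
      by (simp flip: uz)
    finally have "(1 - l * cnj s) *s (ctranspose E *v z) = (- l) *s (ctranspose A *v z)"
      by (rule eq_iff_diff_eq_0[THEN iffD2])
    moreover have "ctranspose B *v z = 0"
    proof (rule cip_right_eqI)
      fix y
      have "cip y (ctranspose B *v z) = cnj (cip u (Mi *v (B *v y)))"
        by (simp add: cip_cnj z_def flip: cip_ctranspose)
      then show "cip y (ctranspose B *v z) = cip y 0"
        by (simp add: W_b[OF u(1)])
    qed
    ultimately have "z = 0"
      by (intro ctrl[of "1 - l * cnj s" "- l"]) auto
    then show False
      using u(2) uz by simp
  qed
  have QW: "ctranspose Q *v z \<in> W" for z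
  proof -
    \<comment> \<open>On the imaginary axis \<open>- cnj s = s\<close>, so \<open>axis\<close> says
      that the adjoint pencil kills \<open>Q *v v\<close>; an invertible pencil then leaves only
      \<open>Q *v v = 0\<close>.\<close>
    have step: "cip (ctranspose Q *v z) v = 0"
      if inj: "\<And>u. (s + e n) *s (E *v u) = A *v u \<Longrightarrow> u = 0"
        and v: "v + e n *s (N *v v) = Mi *v (B *v y)" for n v y
    proof -
      have ev: "(s + e n) *s (E *v v) = A *v v + B *v y"
      proof -
        have "M *v (v + e n *s (N *v v)) = B *v y"
          unfolding v by (rule Mi')
        then have "M *v v + e n *s (E *v v) = B *v y"
          by (simp add: matrix_vector_right_distrib vector_scalar_commute N_def Mi'
              flip: matrix_vector_mul_assoc)
        then show ?thesis
          by (simp add: M vec.scale_left_distrib algebra_simps)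
      qed
      have re: "Re (s + e n) = 0"
        by (simp add: s e_def)
      then have cs: "cnj (s + e n) = - (s + e n)"
        by (simp add: complex_eq_iff)
      have "ctranspose (cpencil E A (s + e n) 1) *v (Q *v v)
          = - (ctranspose A *v (Q *v v) + (s + e n) *s (ctranspose E *v (Q *v v)))"
        unfolding ctranspose_cpencil cs cpencil_mult by (simp add: vec_eq_iff algebra_simps)
      then have "ctranspose (cpencil E A (s + e n) 1) *v (Q *v v) = 0"
        unfolding axis[OF re ev] by simp
      moreover have "u = 0" if "cpencil E A (s + e n) 1 *v u = 0" for u
        using inj[of u] that by (simp add: cpencil_mult)
      then obtain R where "R ** cpencil E A (s + e n) 1 = mat 1"
        by (metis matrix_left_invertible_ker)
      then have "cpencil E A (s + e n) 1 ** R = mat 1"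
        by (simp add: matrix_left_right_inverse)
      then have "ctranspose R ** ctranspose (cpencil E A (s + e n) 1) = mat 1"
        by (simp flip: ctranspose_mult)
      ultimately have "Q *v v = 0"
        by (metis matrix_vector_mul_assoc matrix_vector_mul_lid matrix_vector_mult_0_right)
      then show ?thesis
        by (simp add: cip_ctranspose_left)
    qed
    have "\<forall>\<^sub>F n in sequentially. \<forall>u. (s + e n) *s (E *v u) = A *v u \<longrightarrow> u = 0"
    proof -
      obtain K where K: "0 < K" "\<And>x. norm (N *v x) \<le> norm x * K"
        using bounded_linear.pos_bounded[OF matrix_vector_mul_bounded_linear[of N]] by blast
      have "\<forall>\<^sub>F n in sequentially. norm (e n) < 1 / K"
        using order_tendstoD(2)[OF tendsto_norm[OF e], of "1 / K"] K(1) by simp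
      then show ?thesis
      proof eventually_elim
        case (elim n)
        show ?case
        proof (intro allI impI)
          fix u
          assume "(s + e n) *s (E *v u) = A *v u"
          then have "M *v u + e n *s (E *v u) = 0"
            by (simp add: M vec.scale_left_distrib algebra_simps)
          then have "Mi *v (M *v u + e n *s (E *v u)) = 0"
            by simp
          then have "u + e n *s (N *v u) = 0"
            by (simp add: matrix_vector_right_distrib vector_scalar_commute N_def Mi'
              flip: matrix_vector_mul_assoc)
          then have "norm u = norm (e n) * norm (N *v u)"
            by (metis add_eq_0_iff2 norm_minus_cancel norm_vector_scalar_mult)
          also have "\<dots> \<le> norm (e n) * (norm u * K)"
            using K(2) by (rule mult_left_mono) simp
          finally have "norm u * (1 - norm (e n) * K) \<le> 0"
            by (simp add: algebra_simps)
          moreover have "0 < 1 - norm (e n) * K"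
            using elim K(1) by (simp add: field_simps)
          ultimately show "u = 0"
            by (simp add: mult_le_0_iff)
        qed
      qed
    qed
    then show ?thesis
      unfolding W_def mem_Collect_eq by eventually_elim (use step in blast)
  qed
  have "Q *v v = 0" for v
    using W0[OF QW] by (intro cip_right_eqI) (metis cip_ctranspose_left cip_zero_left cip_zero_right)
  then show ?thesis
    by (simp add: matrix_eq)
qed

end

text \<open>Homogeneity of degree two absorbs a convex weight \<open>u\<close> into the argument as
  \<open>sqrt u\<close>. Caratheodory's theorem bounds the number of terms, and zeros pad the sum to
  a fixed index type.\<close>

lemma convex_hull_range_as_sum:
  fixes \<phi> :: "'z::real_vector \<Rightarrow> 'p::euclidean_space"
  assumes hom: "\<And>t z. \<phi> (t *\<^sub>R z) = t\<^sup>2 *\<^sub>R \<phi> z"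
    and p: "p \<in> convex hull (range \<phi>)" and card: "DIM('p) + 1 \<le> CARD('k::finite)"
  obtains z :: "'k::finite \<Rightarrow> 'z" where "p = (\<Sum>k\<in>UNIV. \<phi> (z k))"
proof -
  obtain T where T: "finite T" "T \<subseteq> range \<phi>" "card T \<le> DIM('p) + 1" "p \<in> convex hull T"
    using p caratheodory[of "range \<phi>"] by auto
  obtain u where u: "\<And>x. x \<in> T \<Longrightarrow> 0 \<le> u x" "(\<Sum>x\<in>T. u x *\<^sub>R x) = p"
    using T(4) unfolding convex_hull_finite[OF T(1)] by auto
  obtain g :: "'p \<Rightarrow> 'k" where g: "inj_on g T"
    using T(1,3) card card_le_inj[of T "UNIV :: 'k set"] by auto
  have "\<exists>\<zeta>. \<forall>x\<in>T. \<phi> (\<zeta> x) = x"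
    using T(2) by (intro bchoice) blast
  then obtain \<zeta> where \<zeta>: "\<And>x. x \<in> T \<Longrightarrow> \<phi> (\<zeta> x) = x"
    by blast
  have \<phi>0: "\<phi> 0 = 0"
    using hom[of 0 0] by simp
  define z where "z k = (if k \<in> g ` T then let x = inv_into T g k in sqrt (u x) *\<^sub>R \<zeta> x else 0)" for k
  have "(\<Sum>k\<in>UNIV. \<phi> (z k)) = (\<Sum>k\<in>g ` T. \<phi> (z k))"
    by (rule sum.mono_neutral_right) (auto simp: z_def \<phi>0)
  also have "\<dots> = (\<Sum>x\<in>T. \<phi> (z (g x)))"
    by (simp add: sum.reindex[OF g])
  also have "\<dots> = (\<Sum>x\<in>T. u x *\<^sub>R x)"
    using g by (intro sum.cong) (auto simp: z_def hom \<zeta> u(1))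
  finally show ?thesis
    using that u(2) by metis
qed

context positive_real_system
begin

lemma kyp_solution_exists:
  obtains Q where "ctranspose Q ** E = ctranspose E ** Q"
    "\<And>v y. Re (cip (Q *v v) (A *v v + B *v y)) \<le> Re (cip y (C *v v + D *v y))"
proof -
  define \<phi> :: "(complex^'n) \<times> (complex^'m) \<Rightarrow> (complex^'n^'n) \<times> real" where
    "\<phi> z = (outer (A *v fst z + B *v snd z) (fst z), Re (cip (snd z) (C *v fst z + D *v snd z)))" for z
  \<comment> \<open>Orthogonality of \<open>Q\<close> to all \<open>E ** S\<close> with
    \<open>S\<close> skew-Hermitian says exactly that \<open>ctranspose E ** Q\<close> is Hermitian.
    The first factor is a real subspace, so a functional bounded above on \<open>T\<close> must
    vanish on it.\<close>
  define T where "T = (\<lambda>S. E ** S) ` {S. ctranspose S = - S} \<times> {r::real. r < 0}"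
  have hom: "\<phi> (t *\<^sub>R z) = t\<^sup>2 *\<^sub>R \<phi> z" for t z
    by (simp add: \<phi>_def matrix_vector_mult_scaleR_right cip_scaleR outer_scaleR
        flip: scaleR_add_right)
  have cT: "convex T"
    unfolding T_def
  proof (intro convex_Times convex_linear_image)
    show "linear (\<lambda>S. E ** S)"
      by (rule linearI) (simp_all add: vec_eq_iff matrix_matrix_mult_def distrib_left sum.distrib
          scaleR_right.sum)
    show "convex {S :: complex^'n^'n. ctranspose S = - S}"
      by (rule convexI) (simp add: vec_eq_iff)
    show "convex {r::real. r < 0}"
      using convex_real_interval(4)[of 0] by (simp add: lessThan_def)
  qed
  have disj: "T \<inter> convex hull (range \<phi>) = {}"
  proof (rule ccontr)
    assume "T \<inter> convex hull (range \<phi>) \<noteq> {}"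
    then obtain p where p: "p \<in> T" "p \<in> convex hull (range \<phi>)"
      by blast
    then obtain S r where S: "p = (E ** S, r)" "ctranspose S = - S" "r < 0"
      by (auto simp: T_def)
    \<comment> \<open>The dimension is \<open>2 n^2 + 1\<close>, so Caratheodory's theorem asks for
      \<open>2 n^2 + 2\<close> points; the two \<open>option\<close> layers add the missing 2 to the
      \<open>2 n^2\<close> elements of \<open>'n \<times> 'n \<times> bool\<close>.\<close>
    have "DIM((complex^'n^'n) \<times> real) + 1 \<le> CARD(('n \<times> 'n \<times> bool) option option)"
      by simp
    then obtain z :: "('n \<times> 'n \<times> bool) option option \<Rightarrow> (complex^'n) \<times> (complex^'m)"
      where z: "p = (\<Sum>k\<in>UNIV. \<phi> (z k))"
      using convex_hull_range_as_sum[of \<phi> p, OF hom p(2)] by metis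
    define V :: "complex^(('n \<times> 'n \<times> bool) option option)^'n" where "V = (\<chi> i k. fst (z k) $ i)"
    define Y :: "complex^(('n \<times> 'n \<times> bool) option option)^'m" where "Y = (\<chi> i k. snd (z k) $ i)"
    have Vn: "V $ i $ k = fst (z k) $ i" and Yn: "Y $ j $ k = snd (z k) $ j" for i j k
      by (simp_all add: V_def Y_def)
    have nth: "(M ** N) $ i $ j = (\<Sum>k\<in>UNIV. M $ i $ k * N $ k $ j)"
      for M :: "complex^'a^'b" and N :: "complex^'c^'a" and i j
      by (simp add: matrix_matrix_mult_def)
    have MV: "(M ** V) $ i $ k = (M *v fst (z k)) $ i" for M :: "complex^'n^'l" and i k
      by (simp add: V_def matrix_matrix_mult_def matrix_vector_mult_def)
    have MY: "(M ** Y) $ i $ k = (M *v snd (z k)) $ i" for M :: "complex^'m^'l" and i k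
      by (simp add: Y_def matrix_matrix_mult_def matrix_vector_mult_def)
    have "((A ** V + B ** Y) ** ctranspose V) $ i $ j = (\<Sum>k\<in>UNIV. fst (\<phi> (z k)) $ i $ j)" for i j
      unfolding nth[of "A ** V + B ** Y"] by (simp add: MV MY Vn \<phi>_def outer_def)
    moreover have "(\<Sum>k\<in>UNIV. fst (\<phi> (z k))) = E ** S"
      using z S(1) by (metis fst_conv fst_sum)
    ultimately have "(A ** V + B ** Y) ** ctranspose V = E ** S"
      by (simp add: vec_eq_iff)
    then have "0 \<le> Re (mtrace (ctranspose Y ** (C ** V + D ** Y)))"
      by (rule mtrace_supply_nonneg[OF _ S(2)])
    also have "mtrace (ctranspose Y ** (C ** V + D ** Y))
        = (\<Sum>k\<in>UNIV. cip (snd (z k)) (C *v fst (z k) + D *v snd (z k)))"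
      unfolding mtrace_def nth[of "ctranspose Y"] by (simp add: MV MY Yn cip_def)
    also have "Re \<dots> = snd p"
      unfolding z by (simp add: \<phi>_def snd_sum)
    finally show False
      using S by simp
  qed
  have "(E ** 0, -1) \<in> T"
    by (auto simp: T_def vec_eq_iff intro!: image_eqI[of _ _ 0])
  then have "T \<noteq> {}"
    by blast
  moreover have "convex hull (range \<phi>) \<noteq> {}"
    by simp
  ultimately obtain a b where ab: "a \<noteq> 0" "\<And>x. x \<in> T \<Longrightarrow> inner a x \<le> b"
    "\<And>x. x \<in> convex hull (range \<phi>) \<Longrightarrow> b \<le> inner a x"
    using separating_hyperplane_sets[OF cT convex_convex_hull _ _ disj] by metis
  obtain R c where a: "a = (R, c)"
    by (cases a)
  have nonneg: "0 \<le> Re (cip (R *v v) (A *v v + B *v y)) + c * Re (cip y (C *v v + D *v y))" for v y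
  proof -
    define q where "q = Re (cip (R *v v) (A *v v + B *v y)) + c * Re (cip y (C *v v + D *v y))"
    have q: "inner a (\<phi> (v, y)) = q"
      by (simp add: a \<phi>_def q_def inner_outer)
    have "b \<le> t\<^sup>2 * q" for t :: real
    proof -
      have "b \<le> inner a (\<phi> (t *\<^sub>R (v, y)))"
        by (intro ab(3) hull_inc) simp
      then show ?thesis
        by (simp only: hom inner_scaleR_right q)
    qed
    have "0 \<le> q"
    proof (rule ccontr)
      assume "\<not> 0 \<le> q"
      \<comment> \<open>The scaling factor brings \<open>t\<^sup>2 * q\<close> down to
        \<open>- (\<bar>b\<bar> + 1)\<close>, below the bound \<open>b\<close>.\<close>
      then have "(sqrt ((\<bar>b\<bar> + 1) / - q))\<^sup>2 * q = - (\<bar>b\<bar> + 1)"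
        by (subst real_sqrt_pow2) (auto simp: field_simps)
      then show False
        using \<open>\<And>t. b \<le> t\<^sup>2 * q\<close>[of "sqrt ((\<bar>b\<bar> + 1) / - q)"] by linarith
    qed
    then show ?thesis
      by (simp add: q_def)
  qed
  have T_le: "inner R (E ** S) * t + c * r \<le> b" if S: "ctranspose S = - S" and r: "r < 0" for S r t
  proof -
    have "(E ** (t *\<^sub>R S), r) \<in> T"
      using S r by (auto simp: T_def vec_eq_iff intro!: image_eqI[of _ _ "t *\<^sub>R S"])
    then have "inner a (E ** (t *\<^sub>R S), r) \<le> b"
      by (rule ab(2))
    moreover have "E ** (t *\<^sub>R S) = t *\<^sub>R (E ** S)"
      by (simp add: vec_eq_iff matrix_matrix_mult_def scaleR_right.sum)
    ultimately show ?thesis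
      by (simp add: a mult.commute)
  qed
  have c: "0 \<le> c"
  proof (rule ccontr)
    assume c: "\<not> 0 \<le> c"
    then have "c * ((\<bar>b\<bar> + 1) / c) = \<bar>b\<bar> + 1"
      by simp
    then show False
      using T_le[of 0 "(\<bar>b\<bar> + 1) / c" 0] c by (auto simp: vec_eq_iff divide_pos_neg)
  qed
  have orth: "inner R (E ** S) = 0" if S: "ctranspose S = - S" for S
  proof (rule ccontr)
    assume "inner R (E ** S) \<noteq> 0"
    then show False
      using T_le[OF S, of "-1" "(\<bar>b\<bar> + c + 1) / inner R (E ** S)"] by simp
  qed
  have "inner (ctranspose E ** R) S = inner R (E ** S)" for S
    by (simp add: inner_matrix_eq_mtrace ctranspose_mult matrix_mul_assoc)
  then have "ctranspose (ctranspose E ** R) = ctranspose E ** R"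
    by (intro hermitian_if_orthogonal_skew) (simp add: orth)
  then have herm: "ctranspose R ** E = ctranspose E ** R"
    by (simp add: ctranspose_mult)
  have c0: "c \<noteq> 0"
  proof
    assume "c = 0"
    then have "R = 0"
      using multiplier_eq_0[OF herm] nonneg by simp
    then show False
      using ab(1) \<open>c = 0\<close> by (simp add: a zero_prod_def)
  qed
  \<comment> \<open>The hyperplane gives \<open>0 \<le> p + c * q\<close> with \<open>c\<close>
    positive; normalizing \<open>c\<close> to 1 and changing the sign of \<open>R\<close> turns this
    into the dissipation inequality.\<close>
  define Q where "Q = (- 1 / c) *\<^sub>R R"
  have Qv: "Q *v v = complex_of_real (- 1 / c) *s (R *v v)" for v
    unfolding Q_def scaleR_eq_vector_scalar_mult[symmetric]
    by (simp only: vec_eq_iff matrix_vector_mult_def vec_lambda_beta vector_scaleR_component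
        scaleR_right.sum mult_scaleR_left) simp
  show ?thesis
  proof (rule that)
    have "ctranspose Q ** E = (- 1 / c) *\<^sub>R (ctranspose R ** E)"
      by (simp add: Q_def vec_eq_iff matrix_matrix_mult_def scaleR_right.sum sum_negf)
    also have "\<dots> = ctranspose E ** Q"
      by (simp add: herm) (simp add: Q_def vec_eq_iff matrix_matrix_mult_def scaleR_right.sum sum_negf)
    finally show "ctranspose Q ** E = ctranspose E ** Q" .
    show "Re (cip (Q *v v) (A *v v + B *v y)) \<le> Re (cip y (C *v v + D *v y))" for v y
    proof -
      define p where "p = Re (cip (R *v v) (A *v v + B *v y))"
      define q where "q = Re (cip y (C *v v + D *v y))"
      have "Re (cip (Q *v v) (A *v v + B *v y)) = - p / c"
        unfolding Qv cip_scale_left by (simp add: p_def del: of_real_divide of_real_minus)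
      also have "0 \<le> p + c * q"
        unfolding p_def q_def by (rule nonneg)
      then have "- p / c \<le> q"
        using c c0 by (simp add: field_simps)
      finally show ?thesis
        by (simp only: q_def)
    qed
  qed
qed

end

section \<open>Positivity and invertibility of the solution\<close>

context positive_real_system
begin

text \<open>Under the feedback \<open>y = - (C v + D y)\<close> the supplied energy is \<open>- |y|\<^sup>2\<close>, so the closed loop is
  asymptotically stable. The matrix \<open>K\<close> below is the Cayley transform of the closed loop.\<close>

lemma storage_nonneg:
  assumes herm: "ctranspose Q ** E = ctranspose E ** Q"
    and kyp: "\<And>v y. Re (cip (Q *v v) (A *v v + B *v y)) \<le> Re (cip y (C *v v + D *v y))"
  shows "0 \<le> Re (cip (E *v x) (Q *v x))"
proof -
  \<comment> \<open>Accretivity of \<open>D\<close> makes \<open>1 + D\<close> invertible, so the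
    implicit feedback law has the solution \<open>fb\<close>.\<close>
  have "y = 0" if "(mat 1 + D) *v y = 0" for y
  proof -
    have "D *v y = - y"
      using that by (simp add: matrix_vector_mult_add_rdistrib add_eq_0_iff)
    then show ?thesis
      using D_accretive[of y] by (simp add: cip_simps cip_self)
  qed
  then obtain ID where ID: "(mat 1 + D) ** ID = mat 1"
    by (metis matrix_left_invertible_ker matrix_left_right_inverse)
  define fb where "fb v = ID *v (- (C *v v))" for v
  have fb: "C *v v + D *v fb v = - fb v" for v
  proof -
    have "(mat 1 + D) *v fb v = - (C *v v)"
      unfolding fb_def by (simp add: matrix_vector_mul_assoc ID)
    then show ?thesis
      by (simp add: matrix_vector_mult_add_rdistrib algebra_simps eq_neg_iff_add_eq_0)
  qed
  define Ac where "Ac = A - B ** (ID ** C)"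
  have Ac: "Ac *v v = A *v v + B *v fb v" for v
  proof -
    have "fb v = - (ID *v (C *v v))"
      using matrix_vector_mult_diff_distrib[of ID 0 "C *v v"] by (simp add: fb_def)
    then have "B *v fb v = - (B *v (ID *v (C *v v)))"
      using matrix_vector_mult_diff_distrib[of B 0 "ID *v (C *v v)"] by simp
    then show ?thesis
      by (simp add: Ac_def matrix_vector_mult_diff_rdistrib flip: matrix_vector_mul_assoc)
  qed
  have fb0: "fb v = 0 \<and> C *v v = 0" if "0 \<le> Re (cip (fb v) (C *v v + D *v fb v))" for v
  proof -
    have "fb v = 0"
      using that unfolding fb by (simp add: cip_simps cip_self)
    then show ?thesis
      using fb[of v] by simp
  qed
  have stable_c: "v = 0" if s: "0 \<le> Re s" and eq: "s *s (E *v v) = Ac *v v" for s v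
  proof -
    have "fb v = 0 \<and> C *v v = 0"
      by (rule fb0[OF positive_closed_half_plane[OF s eq[unfolded Ac]]])
    then show ?thesis
      using obs[of s 1 v] eq by (simp add: Ac)
  qed
  \<comment> \<open>The closed-loop pencil has no chains at infinity, that is, index at most
    one.\<close>
  have stable_inf: "v = 0" if eq: "E *v v = 0" "Ac *v v = E *v v1" for v v1
  proof -
    have "fb v = 0 \<and> C *v v = 0"
      by (rule fb0[OF positive_at_infinity[OF eq(1) eq(2)[unfolded Ac]]])
    then show ?thesis
      using obs[of 1 0 v] eq by simp
  qed
  define M where "M = E - Ac"
  have M: "M *v v = E *v v - Ac *v v" for v
    by (simp add: M_def matrix_vector_mult_diff_rdistrib)
  have "v = 0" if "M *v v = 0" for v
    using stable_c[of 1 v] that by (simp add: M)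
  then obtain Mi where Mi: "Mi ** M = mat 1" "M ** Mi = mat 1"
    by (metis matrix_left_invertible_ker matrix_left_right_inverse)
  have Mi': "M *v (Mi *v x) = x" "Mi *v (M *v x) = x" for x
    by (simp_all add: matrix_vector_mul_assoc Mi)
  \<comment> \<open>With these definitions \<open>K\<close> is
    \<open>(E - Ac)^-1 (E + Ac)\<close>.\<close>
  define N where "N = Mi ** (E + E)"
  define K where "K = N - mat 1"
  have K: "K *v v = N *v v - v" for v
    by (simp add: K_def matrix_vector_mult_diff_rdistrib)
  have MN: "E *v (N *v v) - Ac *v (N *v v) = E *v v + E *v v" for v
    using Mi'(1)[of "(E + E) *v v"]
    unfolding M N_def by (simp only: matrix_vector_mult_add_rdistrib flip: matrix_vector_mul_assoc)
  then have AcN: "Ac *v (N *v v) = E *v (N *v v) - E *v v - E *v v" for v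
    by (metis (no_types) add_diff_cancel_left' diff_diff_add diff_diff_eq2 diff_add_cancel)
  define V where "V v = Re (cip (E *v v) (Q *v v))" for v
  have sym: "cip (E *v v) (Q *v w) = cip (Q *v v) (E *v w)" for v w
    by (simp add: cip_ctranspose matrix_vector_mul_assoc herm)
  have sym': "Re (cip (E *v v) (Q *v w)) = Re (cip (E *v w) (Q *v v))" for v w
    by (metis cip_cnj complex_cnj(1) complex.sel(1) sym cnj.sel(1))
  \<comment> \<open>The difference of the two energies is \<open>Re (cip (Ac *v z) (Q *v z))\<close>
    at \<open>z = N *v v\<close>, which the dissipation inequality under feedback bounds by
    \<open>- |fb z|^2\<close>.\<close>
  have dec: "V (K *v v) \<le> V v" for v
  proof -
    let ?z = "N *v v"
    have "V (K *v v) - V v = Re (cip (E *v ?z - E *v v - E *v v) (Q *v ?z))"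
      using sym'[of ?z v] unfolding V_def K matrix_vector_mult_diff_distrib cip_simps by simp
    also have "E *v ?z - E *v v - E *v v = Ac *v ?z"
      by (simp only: AcN)
    also have "Re (cip (Ac *v ?z) (Q *v ?z)) = Re (cip (Q *v ?z) (Ac *v ?z))"
      by (metis cip_cnj cnj.sel(1))
    also have "\<dots> \<le> 0"
      using kyp[of ?z "fb ?z"] unfolding fb Ac by (simp add: cip_simps cip_self)
        (smt (verit) zero_le_power2)
    finally show ?thesis by simp
  qed
  \<comment> \<open>On the kernel of \<open>E\<close> the matrix \<open>N\<close> vanishes and
    \<open>K\<close> is \<open>-1\<close>, so its powers do not converge there. The range of
    \<open>N\<close> avoids that kernel, as \<open>inj\<close> shows.\<close>
  define W where "W = range ((*v) N)"
  have W: "vec.subspace W"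
    unfolding W_def by (intro vec.linear_subspace_image[OF matrix_vector_mul_linear_gen] vec.subspace_UNIV)
  have KW: "K *v w \<in> W" if "w \<in> W" for w
    using that unfolding W_def K by (auto simp flip: matrix_vector_mult_diff_distrib)
  have inj: "u = 0" if uW: "u \<in> W" "E *v u = 0" for u
  proof -
    obtain w where u: "u = N *v w"
      using uW(1) by (auto simp: W_def)
    have "Ac *v u = 0 - E *v w - E *v w"
      using AcN[of w] uW(2) by (simp only: u)
    also have "\<dots> = E *v (0 - w - w)"
      by (simp only: matrix_vector_mult_diff_distrib matrix_vector_mult_0_right)
    finally show ?thesis
      using stable_inf uW(2) by blast
  qed
  have eig: "norm l < 1" if u: "u \<in> W" "u \<noteq> 0" "K *v u = l *s u" for u l
  proof -
    have "N *v u = (l + 1) *s u"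
      using u(3) by (simp add: K vec.scale_left_distrib algebra_simps)
    then have "(l + 1) *s (Ac *v u) = (l + 1) *s (E *v u) - E *v u - E *v u"
      using AcN[of u] by (simp only: vector_scalar_commute)
    then have eq: "(l - 1) *s (E *v u) = (l + 1) *s (Ac *v u)"
      by (simp add: vec_eq_iff algebra_simps)
    have l: "l + 1 \<noteq> 0"
    proof
      assume "l + 1 = 0"
      then have "l - 1 \<noteq> 0" "(l - 1) *s (E *v u) = 0"
        using eq by (auto simp: add_eq_0_iff2)
      then have "E *v u = 0"
        by (simp only: vec.scale_eq_0_iff) simp
      then show False
        using inj[OF u(1)] u(2) by simp
    qed
    show ?thesis
    proof (rule ccontr)
      \<comment> \<open>The map sending \<open>l\<close> to \<open>(l - 1) / (l + 1)\<close> takes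
        the complement of the open unit disc, without \<open>-1\<close>, into the closed right
        half-plane, where the closed loop has no eigenvalue.\<close>
      assume "\<not> norm l < 1"
      then have "1 \<le> (Re l)\<^sup>2 + (Im l)\<^sup>2"
        by (simp add: cmod_def)
      then have "0 \<le> Re ((l - 1) / (l + 1))"
        unfolding Re_divide
        by (intro divide_nonneg_nonneg sum_power2_ge_zero) (simp add: power2_eq_square algebra_simps)
      moreover have "((l - 1) / (l + 1)) *s (E *v u) = Ac *v u"
      proof -
        have "((l - 1) / (l + 1)) *s (E *v u) = (1 / (l + 1)) *s ((l - 1) *s (E *v u))"
          unfolding vec.scale_scale by simp
        then show ?thesis
          unfolding eq vec.scale_scale using l by simp
      qed
      ultimately show False
        using stable_c u(2) by blast
    qed
  qed
  have VW: "0 \<le> V w" if "w \<in> W" for w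
  proof -
    have lim: "(\<lambda>n. (((*v) K) ^^ n) w) \<longlonglongrightarrow> 0"
      by (rule matrix_power_tendsto_0[OF W KW eig that])
    have le: "V ((((*v) K) ^^ n) w) \<le> V w" for n
      by (induction n) (auto intro: order_trans[OF dec])
    have "(\<lambda>n. V ((((*v) K) ^^ n) w)) \<longlonglongrightarrow> Re (cip (E *v 0) (Q *v 0))"
      unfolding V_def by (intro tendsto_Re tendsto_cip tendsto_matrix_vector_mult lim)
    then show ?thesis
      using le by (intro tendsto_upperbound[of _ 0 sequentially "V w"]) auto
  qed
  \<comment> \<open>\<open>N\<close> is injective on its range \<open>W\<close> and so maps
    \<open>W\<close> onto itself. Every \<open>x\<close> is therefore an element of \<open>W\<close>
    plus a vector in the kernel of \<open>N\<close>, which lies in the kernel of \<open>E\<close>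
    and does not affect \<open>V\<close>.\<close>
  have lin: "linear ((*v) N)"
    by simp
  have sW: "subspace W"
    unfolding W_def by (rule linear_subspace_image[OF lin subspace_UNIV])
  have "inj_on ((*v) N) (span W)"
  proof -
    have ker: "v = 0" if v: "v \<in> W" "N *v v = 0" for v
    proof -
      have "E *v v = 0"
        using AcN[of v] unfolding v(2) by (simp add: vec_eq_iff)
      then show ?thesis
        using inj v(1) by blast
    qed
    have span: "span W = W"
      using sW by (simp add: span_eq_iff)
    show ?thesis
    proof (rule inj_onI)
      fix a b
      assume "a \<in> span W" "b \<in> span W" "N *v a = N *v b"
      then have "a - b \<in> W" "N *v (a - b) = 0"
        using vec.subspace_diff[OF W] by (simp_all add: span matrix_vector_mult_diff_distrib)
      then show "a = b"
        using ker[of "a - b"] by simp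
    qed
  qed
  then have "dim ((*v) N ` W) = dim W"
    by (rule dim_image_eq[OF lin])
  moreover have "subspace ((*v) N ` W)"
    by (rule linear_subspace_image[OF lin sW])
  ultimately have NW: "(*v) N ` W = W"
    using sW by (intro subspace_dim_equal) (auto simp: W_def)
  have "N *v x \<in> W"
    by (simp add: W_def)
  then obtain w where w: "w \<in> W" "N *v w = N *v x"
    using NW by (metis imageE)
  define k where "k = x - w"
  have "N *v k = 0"
    by (simp add: k_def matrix_vector_mult_diff_distrib w)
  then have Ek: "E *v k = 0"
    using AcN[of k] unfolding \<open>N *v k = 0\<close> by (simp add: vec_eq_iff)
  have "V x = V (w + k)"
    by (simp add: k_def)
  also have "\<dots> = V w"
    by (simp add: V_def matrix_vector_right_distrib Ek cip_simps sym)
  finally show ?thesis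
    using VW[OF w(1)] by (simp add: V_def)
qed

text \<open>The kernel of \<open>Q\<close> is annihilated by \<open>C\<close> and invariant under
  \<open>(E - A)^-1 E\<close>. An eigenvector in it would be unobservable.\<close>

lemma kyp_solution_injective:
  assumes herm: "ctranspose Q ** E = ctranspose E ** Q"
    and kyp: "\<And>v y. Re (cip (Q *v v) (A *v v + B *v y)) \<le> Re (cip y (C *v v + D *v y))"
    and x: "Q *v x = 0"
  shows "x = 0"
proof (rule ccontr)
  assume "x \<noteq> 0"
  define W where "W = {x. Q *v x = 0}"
  have W: "vec.subspace W"
    by (simp add: W_def vec.subspace_def matrix_vector_right_distrib vector_scalar_commute)
  define M where "M = E - A"
  have M: "M *v v = E *v v - A *v v" for v
    by (simp add: M_def matrix_vector_mult_diff_rdistrib)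
  have "v = 0" if "M *v v = 0" for v
    using stable[of 1 v] that by (simp add: M)
  then obtain Mi where Mi: "Mi ** M = mat 1" "M ** Mi = mat 1"
    by (metis matrix_left_invertible_ker matrix_left_right_inverse)
  have Mi': "M *v (Mi *v x) = x" for x
    by (simp_all add: matrix_vector_mul_assoc Mi)
  have MiH: "ctranspose Mi *v (ctranspose M *v x) = x" for x
    by (simp_all add: matrix_vector_mul_assoc Mi flip: ctranspose_mult)
  have C0: "C *v w = 0" if w: "w \<in> W" for w
  proof -
    have "0 \<le> t * Re (cip (C *v w) (C *v w)) + t\<^sup>2 * Re (cip (C *v w) (D *v (C *v w)))" for t :: real
      using kyp[of w "of_real t *s (C *v w)"] w
      by (simp add: W_def vector_scalar_commute cip_simps power2_eq_square algebra_simps)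
    then have "Re (cip (C *v w) (C *v w)) = 0"
      by (rule real_quadratic_nonneg_imp_0)
    then show ?thesis
      by (simp add: cip_self)
  qed
  \<comment> \<open>Dissipation without input and nonnegative storage make
    \<open>Re (cip (Q *v v) (M *v v))\<close> nonnegative. At \<open>u\<close> it vanishes, since
    \<open>M *v u = E *v w\<close> and \<open>E^* Q w = 0\<close>; \<open>accretive_kernel\<close>
    then gives \<open>M^* Q u = 0\<close>.\<close>
  have inv: "(Mi ** E) *v w \<in> W" if w: "w \<in> W" for w
  proof -
    define u where "u = (Mi ** E) *v w"
    have Mu: "M *v u = E *v w"
      by (simp add: u_def Mi' flip: matrix_vector_mul_assoc)
    have QMu: "ctranspose Q *v (M *v u) = 0"
      using w by (simp add: Mu W_def matrix_vector_mul_assoc herm)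
        (simp flip: matrix_vector_mul_assoc)
    have "(ctranspose Q ** M) *v u + ctranspose (ctranspose Q ** M) *v u = 0"
    proof (rule accretive_kernel)
      fix v
      have "Re (cip (Q *v v) (A *v v)) \<le> 0"
        using kyp[of v 0] by simp
      moreover have "0 \<le> Re (cip (Q *v v) (E *v v))"
        using storage_nonneg[OF herm kyp, of v] by (metis cip_cnj cnj.sel(1))
      ultimately show "0 \<le> Re (cip v (ctranspose Q ** M *v v))"
        by (simp add: M cip_simps flip: matrix_vector_mul_assoc cip_ctranspose)
    next
      show "Re (cip u (ctranspose Q ** M *v u)) = 0"
        by (simp add: QMu flip: matrix_vector_mul_assoc)
    qed
    then have "ctranspose M *v (Q *v u) = 0"
      by (simp add: ctranspose_mult QMu flip: matrix_vector_mul_assoc)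
    then have "Q *v u = 0"
      by (metis MiH matrix_vector_mult_0_right)
    then show ?thesis
      by (simp add: W_def u_def)
  qed
  have "x \<in> W"
    using x by (simp add: W_def)
  then obtain u l where u: "u \<in> W" "u \<noteq> 0" "(Mi ** E) *v u = l *s u"
    using ex_eigenvector_in_subspace[OF W inv _ \<open>x \<noteq> 0\<close>] by blast
  have "E *v u = M *v ((Mi ** E) *v u)"
    by (simp add: Mi' flip: matrix_vector_mul_assoc)
  also have "\<dots> = l *s (E *v u - A *v u)"
    by (simp add: u(3) vector_scalar_commute M)
  finally have "(1 - l) *s (E *v u) = (- l) *s (A *v u)"
    by (simp add: vec_eq_iff algebra_simps)
  then show False
    using obs[of "1 - l" "- l" u] C0[OF u(1)] u(2) by auto
qed

end

section \<open>Real systems\<close>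

lemma full_row_rank_independent:
  fixes X :: "'a::field^'k^'n"
  assumes rank: "rank X = CARD('n)" and 0: "(\<Sum>i\<in>UNIV. c i *s row i X) = 0"
  shows "c i = 0"
proof -
  have rows: "rows X = range (\<lambda>i. row i X)"
    by (auto simp: rows_def)
  have card_le: "card (rows X) \<le> CARD('n)"
    unfolding rows by (rule card_image_le) simp
  obtain B where B: "B \<subseteq> rows X" "vec.independent B" "card B = CARD('n)"
    using vec.basis_exists[of "rows X"] rank unfolding row_rank_def_gen by metis
  \<comment> \<open>\<open>rows X\<close> is a set, in which equal rows would collapse; containing a
    basis of \<open>CARD('n)\<close> elements, it can have no repetitions.\<close>
  have "B = rows X"
    using B card_le by (intro card_seteq) (simp_all add: rows)
  then have ind: "vec.independent (rows X)" and card: "card (rows X) = CARD('n)"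
    using B by simp_all
  then have inj: "inj (\<lambda>i. row i X)"
    unfolding rows by (intro eq_card_imp_inj_on) simp_all
  define u where "u r = c (inv (\<lambda>i. row i X) r)" for r
  have "(\<Sum>r\<in>rows X. u r *s r) = 0"
    unfolding rows using 0 by (simp add: sum.reindex[OF inj] u_def inv_f_f[OF inj])
  then have "u r = 0" if "r \<in> rows X" for r
    using ind that vec.independentD[of "rows X" "rows X" u r] by (simp add: rows)
  from this[of "row i X"] show ?thesis
    by (simp add: u_def inv_f_f[OF inj] rows)
qed

lemma full_column_rank_injective:
  fixes X :: "'a::field^'n^'k"
  assumes "rank X = CARD('n)" and "X *v v = 0"
  shows "v = 0"
proof -
  have "vec.dim (rows X) = vec.dim (UNIV :: ('a^'n) set)"
    using assms(1) unfolding row_rank_def_gen vec_dim_card .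
  then have "vec.span (rows X) = vec.span UNIV"
    by (intro vec.dim_eq_span) simp_all
  then have "\<exists>Y. Y ** X = mat 1"
    unfolding matrix_left_invertible_span_rows_gen by simp
  then show ?thesis
    using assms(2) by (simp add: matrix_left_invertible_ker)
qed

lemma sum_UNIV_sum_type: "sum f (UNIV :: ('a::finite + 'b::finite) set) = (\<Sum>a\<in>UNIV. f (Inl a)) + (\<Sum>b\<in>UNIV. f (Inr b))"
  by (simp add: sum.Plus flip: UNIV_Plus_UNIV)

section \<open>The finite spectrum of a regular pencil\<close>

lemma det_affine_poly:
  fixes P R :: "complex^'n^'n"
  obtains p where "\<And>t. poly p t = det (\<chi> i j. P $ i $ j + t * R $ i $ j)"
proof -
  define p where "p = (\<Sum>\<sigma> | \<sigma> permutes (UNIV :: 'n set).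
    [:of_int (sign \<sigma>):] * (\<Prod>i\<in>UNIV. [:P $ i $ \<sigma> i, R $ i $ \<sigma> i:]))"
  have "poly p t = det (\<chi> i j. P $ i $ j + t * R $ i $ j)" for t
    by (simp add: p_def det_def poly_sum poly_prod)
  then show ?thesis
    by (rule that)
qed

lemma pencil_eq_cpencil: "pencil E A a b = cpencil (cmat E) (cmat A) a b"
  by (simp add: pencil_def cpencil_def)

lemma ctranspose_cmat: "ctranspose (cmat M) = cmat (transpose M)"
  by (simp add: vec_eq_iff transpose_def)

lemma det_nonzero_iff_injective:
  fixes M :: "'a::field^'n^'n"
  shows "det M \<noteq> 0 \<longleftrightarrow> (\<forall>v. M *v v = 0 \<longrightarrow> v = 0)"
  by (simp add: invertible_left_inverse matrix_left_invertible_ker flip: invertible_det_nz)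

lemma regular_pencil_finite_spectrum:
  assumes "regular_pencil E A"
  shows "finite {s. det (pencil E A s 1) = 0}"
proof -
  have inj: "det (pencil E A a b) \<noteq> 0 \<longleftrightarrow> (\<forall>v. a *s (cmat E *v v) = b *s (cmat A *v v) \<longrightarrow> v = 0)" for a b
    by (simp add: pencil_eq_cpencil det_nonzero_iff_injective cpencil_mult)
  obtain a b where ab: "det (pencil E A a b) \<noteq> 0"
    using assms by (auto simp: regular_pencil_def)
  obtain p where p: "\<And>t. poly p t = det (\<chi> i j. (- cmat A) $ i $ j + t * cmat E $ i $ j)"
    by (rule det_affine_poly[of "- cmat A" "cmat E"], rule that)
  have p': "poly p s = det (pencil E A s 1)" for s
    unfolding p pencil_def by (simp add: algebra_simps)
  have "\<exists>s. poly p s \<noteq> 0"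
  proof (cases "b = 0")
    case False
    have "\<forall>v. (a / b) *s (cmat E *v v) = 1 *s (cmat A *v v) \<longrightarrow> v = 0"
    proof (intro allI impI)
      fix v
      assume "(a / b) *s (cmat E *v v) = 1 *s (cmat A *v v)"
      then have "b *s ((a / b) *s (cmat E *v v)) = b *s (cmat A *v v)"
        by simp
      then have "a *s (cmat E *v v) = b *s (cmat A *v v)"
        unfolding vec.scale_scale using False by simp
      then show "v = 0"
        using ab unfolding inj by blast
    qed
    then show ?thesis
      unfolding p' inj by blast
  next
    \<comment> \<open>Regularity is witnessed at infinity only, so \<open>E\<close> is invertible.
      The determinant of \<open>E - t A\<close> is a polynomial in \<open>t\<close> that is nonzero
      at 0, hence also at some \<open>t \<noteq> 0\<close>, and \<open>1 / t\<close> is a finite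
      regular frequency.\<close>
    case True
    obtain q where q: "\<And>t. poly q t = det (\<chi> i j. cmat E $ i $ j + t * (- cmat A) $ i $ j)"
      by (rule det_affine_poly[of "cmat E" "- cmat A"], rule that)
    have q': "poly q t = det (pencil E A 1 t)" for t
      unfolding q pencil_def by simp
    have "v = 0" if "cmat E *v v = 0" for v
      using ab that unfolding inj True by simp
    then have "poly q 0 \<noteq> 0"
      unfolding q' inj by simp
    then have "finite {t. poly q t = 0}"
      by (intro poly_roots_finite) auto
    then have "infinite (- insert 0 {t. poly q t = 0})"
      by (simp add: infinite_UNIV_char_0 Compl_eq_Diff_UNIV)
    then obtain t where t: "t \<noteq> 0" "poly q t \<noteq> 0"
      using infinite_imp_nonempty by blast
    have "\<forall>v. (1 / t) *s (cmat E *v v) = 1 *s (cmat A *v v) \<longrightarrow> v = 0"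
    proof (intro allI impI)
      fix v
      assume "(1 / t) *s (cmat E *v v) = 1 *s (cmat A *v v)"
      then have "t *s ((1 / t) *s (cmat E *v v)) = t *s (cmat A *v v)"
        by simp
      then have "1 *s (cmat E *v v) = t *s (cmat A *v v)"
        unfolding vec.scale_scale using t(1) by simp
      then show "v = 0"
        using t(2) unfolding q' inj by blast
    qed
    then show ?thesis
      unfolding p' inj by blast
  qed
  then have "p \<noteq> 0"
    by auto
  then show ?thesis
    using poly_roots_finite[of p] by (simp add: p')
qed

section \<open>From transfer functions and rank conditions to trajectories\<close>

lemma transfer_mult:
  assumes det: "det (pencil E A s 1) \<noteq> 0"
    and eq: "s *s (cmat E *v v) = cmat A *v v + cmat B *v y"
  shows "transfer E A B C D s *v y = cmat C *v v + cmat D *v y"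
proof -
  let ?M = "pencil E A s 1"
  have "invertible ?M"
    using det by (simp add: invertible_det_nz)
  then have inv: "matrix_inv ?M ** ?M = mat 1"
    unfolding matrix_inv_def invertible_def by (rule someI2_ex) simp
  have "?M *v v = cmat B *v y"
    by (simp add: pencil_eq_cpencil cpencil_mult eq)
  then have "matrix_inv ?M *v (cmat B *v y) = v"
    by (metis inv matrix_vector_mul_assoc matrix_vector_mul_lid)
  then show ?thesis
    by (simp add: transfer_def matrix_vector_mult_add_rdistrib flip: matrix_vector_mul_assoc)
qed

lemma controllable_cmat:
  fixes E A :: "real^'n^'n" and B :: "real^'m^'n"
  assumes "completely_controllable E A B"
  shows "controllable (cmat E) (cmat A) (cmat B)"
proof
  fix a b z
  assume ab: "(a, b) \<noteq> (0, 0)"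
    and E: "a *s (ctranspose (cmat E) *v z) = b *s (ctranspose (cmat A) *v z)"
    and B: "ctranspose (cmat B) *v z = 0"
  let ?X = "hcat (pencil E A (cnj a) (cnj b)) (cmat B)"
  have rank: "rank ?X = CARD('n)"
    using assms ab unfolding completely_controllable_def by simp
  have "ctranspose (pencil E A (cnj a) (cnj b)) *v z = 0"
    using E by (simp add: pencil_eq_cpencil ctranspose_cpencil cpencil_mult)
  then have 1: "(\<Sum>i\<in>UNIV. cnj (z $ i) * pencil E A (cnj a) (cnj b) $ i $ j) = 0" for j
  proof -
    assume "ctranspose (pencil E A (cnj a) (cnj b)) *v z = 0"
    then have "cnj ((ctranspose (pencil E A (cnj a) (cnj b)) *v z) $ j) = 0"
      by simp
    then show ?thesis
      by (simp add: matrix_vector_mult_def mult.commute)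
  qed
  have 2: "(\<Sum>i\<in>UNIV. cnj (z $ i) * cmat B $ i $ j) = 0" for j
  proof -
    have "cnj ((ctranspose (cmat B) *v z) $ j) = 0"
      by (simp add: B)
    then show ?thesis
      by (simp add: matrix_vector_mult_def mult.commute)
  qed
  have "(\<Sum>i\<in>UNIV. cnj (z $ i) *s row i ?X) $ j = 0" for j
    using 1 2 by (cases j) (simp_all add: row_def hcat_def)
  then have "(\<Sum>i\<in>UNIV. cnj (z $ i) *s row i ?X) = 0"
    by (simp add: vec_eq_iff)
  then have "cnj (z $ i) = 0" for i
    by (rule full_row_rank_independent[OF rank])
  then show "z = 0"
    by (simp add: vec_eq_iff)
qed

lemma completely_observableD:
  fixes E A :: "real^'n^'n" and C :: "real^'n^'p"
  assumes "completely_observable E A C" and ab: "(a, b) \<noteq> (0, 0)"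
    and E: "a *s (cmat E *v v) = b *s (cmat A *v v)" and C: "cmat C *v v = 0"
  shows "v = 0"
proof (rule full_column_rank_injective)
  show "rank (vcat (pencil E A a b) (cmat C)) = CARD('n)"
    using assms unfolding completely_observable_def by simp
  have P: "pencil E A a b *v v = 0"
    using E by (simp add: pencil_eq_cpencil cpencil_mult)
  have "(vcat (pencil E A a b) (cmat C) *v v) $ i = 0" for i
    using arg_cong[OF P, of "\<lambda>w. w $ projl i"] arg_cong[OF C, of "\<lambda>w. w $ projr i"]
    by (cases i) (simp_all add: vcat_def matrix_vector_mult_def)
  then show "vcat (pencil E A a b) (cmat C) *v v = 0"
    by (simp add: vec_eq_iff)
qed

definition re_vec :: "complex^'n \<Rightarrow> real^'n" where
  "re_vec v = (\<chi> i. Re (v $ i))"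

definition im_vec :: "complex^'n \<Rightarrow> real^'n" where
  "im_vec v = (\<chi> i. Im (v $ i))"

definition cvec :: "real^'n \<Rightarrow> complex^'n" where
  "cvec x = (\<chi> i. complex_of_real (x $ i))"

lemma parts_mult: "re_vec (cmat M *v v) = M *v re_vec v" "im_vec (cmat M *v v) = M *v im_vec v"
  by (simp_all add: re_vec_def im_vec_def vec_eq_iff matrix_vector_mult_def)

lemma parts_add: "re_vec (v + w) = re_vec v + re_vec w" "im_vec (v + w) = im_vec v + im_vec w"
  by (simp_all add: re_vec_def im_vec_def vec_eq_iff)

lemma Re_cip: "Re (cip v w) = re_vec v \<bullet> re_vec w + im_vec v \<bullet> im_vec w"
  by (simp add: cip_def inner_vec_def re_vec_def im_vec_def sum.distrib)

lemma parts_cvec [simp]: "re_vec (cvec x) = x" "im_vec (cvec x) = 0"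
  by (simp_all add: re_vec_def im_vec_def cvec_def vec_eq_iff)

lemma cmat_mult_cvec: "cmat M *v cvec x = cvec (M *v x)"
  by (simp add: cvec_def vec_eq_iff matrix_vector_mult_def)

lemma inner_transpose_mult: "x \<bullet> (transpose M *v y) = (M *v x) \<bullet> y" for M :: "real^'n^'m"
  by (metis dot_lmul_matrix inner_commute transpose_matrix_vector)

lemma matrix_vector_mult_minus: "(- M) *v x = - (M *v x)" for M :: "'a::ring_1^'n^'m"
  using matrix_vector_mult_diff_rdistrib[of 0 M x] by simp

lemma psd_symmetric_part_iff: "psd (D + transpose D) \<longleftrightarrow> (\<forall>x. 0 \<le> x \<bullet> (D *v x))"
proof -
  have "transpose (D + transpose D) = D + transpose D"
    by (simp add: vec_eq_iff transpose_def)
  moreover have "x \<bullet> ((D + transpose D) *v x) = 2 * (x \<bullet> (D *v x))" for x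
    by (simp add: matrix_vector_mult_add_rdistrib inner_add_right inner_transpose_mult
        inner_commute[of "D *v x"] del: transpose_matrix_vector)
  ultimately show ?thesis
    by (simp add: psd_def)
qed

text \<open>Near a hypothetical pole \<open>s\<close> in the open half-plane, perturbing \<open>(v, 0)\<close> gives inputs tending
  to \<open>0\<close> whose outputs tend to \<open>C v\<close>; boundedness of the transfer function forces \<open>C v = 0\<close>.\<close>

lemma positive_real_system_cmat:
  fixes E A :: "real^'n^'n" and B :: "real^'m^'n" and C :: "real^'n^'m" and D :: "real^'m^'m"
  assumes reg: "regular_pencil E A" and ctrl: "completely_controllable E A B"
    and obs: "completely_observable E A C" and pr: "positive_real E A B C D"
    and D: "psd (D + transpose D)"
  shows "positive_real_system (cmat E) (cmat A) (cmat B) (cmat C) (cmat D)"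
proof -
  interpret controllable "cmat E" "cmat A" "cmat B"
    by (rule controllable_cmat[OF ctrl])
  obtain F where F: "\<And>i j. (\<lambda>s. F s $ i $ j) analytic_on {s. 0 < Re s}"
    "\<And>s. 0 < Re s \<Longrightarrow> det (pencil E A s 1) \<noteq> 0 \<Longrightarrow> F s = transfer E A B C D s"
    "\<And>s. 0 < Re s \<Longrightarrow> hermitian_psd (F s + ctranspose (F s))"
    using pr unfolding positive_real_def by blast
  have fin: "finite {s. det (pencil E A s 1) = 0}"
    by (rule regular_pencil_finite_spectrum[OF reg])
  have stable: "v = 0" if s: "0 < Re s" and eq: "s *s (cmat E *v v) = cmat A *v v" for s v
  proof -
    \<comment> \<open>Moving \<open>s\<close> to the right keeps it in the half-plane and eventually
      avoids the finite spectrum, so \<open>F\<close> is given by the transfer formula along the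
      sequence even if \<open>s\<close> itself is a singular point.\<close>
    define e where "e n = complex_of_real (inverse (real (Suc n)))" for n
    have "(\<lambda>n. complex_of_real (inverse (real (Suc n)))) \<longlonglongrightarrow> complex_of_real 0"
      by (intro tendsto_of_real LIMSEQ_inverse_real_of_nat)
    then have e: "e \<longlonglongrightarrow> 0"
      unfolding e_def by simp
    have e_nz: "e n \<noteq> 0" and e_pos: "0 < Re (e n)" for n
      by (simp_all add: e_def del: of_nat_Suc)
    have lim: "(\<lambda>n. s + e n) \<longlonglongrightarrow> s"
      using tendsto_add[OF tendsto_const[of s] e] by simp
    have "\<forall>\<^sub>F n in sequentially. \<forall>r\<in>{s. det (pencil E A s 1) = 0}. s + e n \<noteq> r"
    proof (rule eventually_ball_finite[OF fin], rule ballI)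
      fix r
      show "\<forall>\<^sub>F n in sequentially. s + e n \<noteq> r"
        using tendsto_imp_eventually_ne[OF lim, of r] e_nz by (cases "r = s") auto
    qed
    then have ev: "\<forall>\<^sub>F n in sequentially. F (s + e n) = transfer E A B C D (s + e n) \<and>
        det (pencil E A (s + e n) 1) \<noteq> 0"
    proof eventually_elim
      case (elim n)
      have "0 < Re (s + e n)"
        using s e_pos[of n] by simp
      with elim show ?case
        using F(2)[of "s + e n"] by blast
    qed
    have eq0: "s *s (cmat E *v v) = cmat A *v v + cmat B *v 0"
      using eq by simp
    obtain v' y' where v': "v' \<longlonglongrightarrow> v" "y' \<longlonglongrightarrow> 0"
      "\<forall>\<^sub>F n in sequentially. (s + e n) *s (cmat E *v v' n) = cmat A *v v' n + cmat B *v y' n"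
      by (rule perturb_finite[OF eq0 e])
    have "(\<lambda>n. F (s + e n) *v y' n) \<longlonglongrightarrow> F s *v 0"
    proof (rule vec_tendstoI)
      fix i
      have "isCont (\<lambda>s. F s $ i $ j) s" for j
        using F(1)[of i j] s by (intro analytic_at_imp_isCont) (auto elim: analytic_on_subset)
      then have Fij: "(\<lambda>n. F (s + e n) $ i $ j) \<longlonglongrightarrow> F s $ i $ j" for j
        using isCont_tendsto_compose[OF _ lim] by blast
      show "(\<lambda>n. (F (s + e n) *v y' n) $ i) \<longlonglongrightarrow> (F s *v 0) $ i"
        unfolding matrix_vector_mult_def
        by (simp only: vec_lambda_beta) (intro tendsto_sum tendsto_mult Fij tendsto_vec_nth[OF v'(2)])
    qed
    moreover have "\<forall>\<^sub>F n in sequentially. F (s + e n) *v y' n = cmat C *v v' n + cmat D *v y' n"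
      using ev v'(3) by eventually_elim (use transfer_mult in metis)
    ultimately have "(\<lambda>n. cmat C *v v' n + cmat D *v y' n) \<longlonglongrightarrow> F s *v 0"
      by (rule Lim_transform_eventually)
    moreover have "(\<lambda>n. cmat C *v v' n + cmat D *v y' n) \<longlonglongrightarrow> cmat C *v v + cmat D *v 0"
      by (intro tendsto_add tendsto_matrix_vector_mult v')
    ultimately have "cmat C *v v = 0"
      using LIMSEQ_unique by fastforce
    then show ?thesis
      using eq by (intro completely_observableD[OF obs, of s 1]) simp_all
  qed
  show ?thesis
  proof
    show "v = 0" if "(a, b) \<noteq> (0, 0)" "a *s (cmat E *v v) = b *s (cmat A *v v)" "cmat C *v v = 0"
      for a b v
      using that by (rule completely_observableD[OF obs])
    show "v = 0" if "0 < Re s" "s *s (cmat E *v v) = cmat A *v v" for s v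
      using that by (rule stable)
    show "0 \<le> Re (cip y (cmat C *v v + cmat D *v y))"
      if s: "0 < Re s" and eq: "s *s (cmat E *v v) = cmat A *v v + cmat B *v y" for s v y
    proof -
      have det: "det (pencil E A s 1) \<noteq> 0"
        unfolding det_nonzero_iff_injective pencil_eq_cpencil cpencil_mult
        using stable[OF s] by simp
      have "0 \<le> Re (cip y ((F s + ctranspose (F s)) *v y))"
        using F(3)[OF s] unfolding hermitian_psd_def cip_def by blast
      also have "\<dots> = Re (cip y (F s *v y)) + Re (cnj (cip y (F s *v y)))"
        unfolding cip_cnj by (simp add: matrix_vector_mult_add_rdistrib cip_add_right cip_ctranspose)
      finally show ?thesis
        using transfer_mult[OF det eq, of C D] F(2)[OF s det] by simp
    qed
    show "0 \<le> Re (cip y (cmat D *v y))" for y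
      using D unfolding psd_symmetric_part_iff Re_cip parts_mult by simp
    show "\<exists>s. Re s = 0 \<and> (\<forall>v. s *s (cmat E *v v) = cmat A *v v \<longrightarrow> v = 0)"
    proof -
      \<comment> \<open>The imaginary axis is infinite and the spectrum finite.\<close>
      have "inj (\<lambda>t. \<i> * complex_of_real t)"
        by (rule injI) simp
      then have "infinite (range (\<lambda>t. \<i> * complex_of_real t))"
        by (simp add: finite_image_iff infinite_UNIV_char_0)
      then have "\<not> range (\<lambda>t. \<i> * complex_of_real t) \<subseteq> {s. det (pencil E A s 1) = 0}"
        using fin finite_subset by metis
      then obtain t where "det (pencil E A (\<i> * complex_of_real t) 1) \<noteq> 0"
        by (auto simp: image_subset_iff)
      then show ?thesis
        unfolding det_nonzero_iff_injective pencil_eq_cpencil cpencil_mult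
        by (intro exI[of _ "\<i> * complex_of_real t"]) simp
    qed
  qed
qed

text \<open>On real vectors only the real part of \<open>Q'\<close> enters, and with real data both
  conditions pass to it. Invertibility need not survive taking real parts, so nonnegativity and
  injectivity are derived afresh for \<open>cmat Q\<close>, again a complex solution.\<close>

lemma real_kyp_solution:
  fixes E A :: "real^'n^'n" and B :: "real^'m^'n" and C :: "real^'n^'m" and D :: "real^'m^'m"
  assumes sys: "positive_real_system (cmat E) (cmat A) (cmat B) (cmat C) (cmat D)"
  obtains Q where "transpose Q ** E = transpose E ** Q"
    "\<And>x u. (Q *v x) \<bullet> (A *v x + B *v u) \<le> u \<bullet> (C *v x + D *v u)"
    "\<And>x. 0 \<le> (E *v x) \<bullet> (Q *v x)" "invertible Q"
proof -
  interpret positive_real_system "cmat E" "cmat A" "cmat B" "cmat C" "cmat D"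
    by (rule sys)
  obtain Q' where Q': "ctranspose Q' ** cmat E = ctranspose (cmat E) ** Q'"
    "\<And>v y. Re (cip (Q' *v v) (cmat A *v v + cmat B *v y)) \<le> Re (cip y (cmat C *v v + cmat D *v y))"
    by (rule kyp_solution_exists, rule that)
  define Q :: "real^'n^'n" where "Q = (\<chi> i j. Re (Q' $ i $ j))"
  have sym: "transpose Q ** E = transpose E ** Q"
  proof -
    have "Re ((ctranspose Q' ** cmat E) $ i $ j) = Re ((ctranspose (cmat E) ** Q') $ i $ j)" for i j
      by (simp only: Q')
    then show ?thesis
      by (simp add: vec_eq_iff matrix_matrix_mult_def transpose_def Q_def)
  qed
  have kyp: "(Q *v x) \<bullet> (A *v x + B *v u) \<le> u \<bullet> (C *v x + D *v u)" for x u
  proof -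
    have "re_vec (Q' *v cvec x) = Q *v x"
      by (simp add: re_vec_def Q_def cvec_def matrix_vector_mult_def vec_eq_iff)
    then show ?thesis
      using Q'(2)[of "cvec x" "cvec u"] by (simp add: Re_cip parts_add parts_mult)
  qed
  have herm: "ctranspose (cmat Q) ** cmat E = ctranspose (cmat E) ** cmat Q"
  proof -
    have "cmat (transpose Q ** E) = cmat (transpose E ** Q)"
      by (simp only: sym)
    then show ?thesis
      by (simp add: ctranspose_cmat vec_eq_iff matrix_matrix_mult_def)
  qed
  have kyp': "Re (cip (cmat Q *v v) (cmat A *v v + cmat B *v y))
      \<le> Re (cip y (cmat C *v v + cmat D *v y))" for v y
    unfolding Re_cip parts_add parts_mult by (intro add_mono kyp)
  have "0 \<le> (E *v x) \<bullet> (Q *v x)" for x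
    using storage_nonneg[OF herm kyp', of "cvec x"] by (simp add: cmat_mult_cvec Re_cip)
  moreover have "x = 0" if "Q *v x = 0" for x
  proof -
    have "cmat Q *v cvec x = 0"
      unfolding cmat_mult_cvec that by (simp add: cvec_def vec_eq_iff)
    then have "cvec x = 0"
      by (rule kyp_solution_injective[OF herm kyp'])
    then show ?thesis
      by (simp add: cvec_def vec_eq_iff)
  qed
  then have "invertible Q"
    by (simp add: invertible_left_inverse matrix_left_invertible_ker)
  ultimately show ?thesis
    using that sym kyp by blast
qed

section \<open>Block matrices and the port-Hamiltonian form\<close>

lemma block_mat_mult_Inl: "(block_mat X Y Z W *v x) $ Inl i = (X *v (\<chi> a. x $ Inl a)) $ i + (Y *v (\<chi> b. x $ Inr b)) $ i"
  and block_mat_mult_Inr: "(block_mat X Y Z W *v x) $ Inr j = (Z *v (\<chi> a. x $ Inl a)) $ j + (W *v (\<chi> b. x $ Inr b)) $ j"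
  by (simp_all add: block_mat_def vcat_def hcat_def matrix_vector_mult_def sum_UNIV_sum_type)

lemma block_mat_quadratic_form:
  fixes x :: "real^('n::finite + 'm::finite)"
  defines "a \<equiv> \<chi> i. x $ Inl i" and "u \<equiv> \<chi> i. x $ Inr i"
  shows "x \<bullet> (block_mat X Y Z W *v x) = a \<bullet> (X *v a + Y *v u) + u \<bullet> (Z *v a + W *v u)"
  by (simp add: inner_vec_def sum_UNIV_sum_type block_mat_mult_Inl block_mat_mult_Inr a_def u_def)

lemma transpose_block_mat:
  "transpose (block_mat X Y Z W) = block_mat (transpose X) (transpose Z) (transpose Y) (transpose W)"
  by (simp add: vec_eq_iff transpose_def block_mat_def vcat_def hcat_def split: sum.split)

lemma uminus_block_mat:
  "- block_mat X Y Z W = block_mat (- X) (- Y) (- Z) (- W)"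
  by (simp add: vec_eq_iff block_mat_def vcat_def hcat_def split: sum.split)

text \<open>\<open>S\<close> is a principal block of the dissipation matrix; vectors
  \<open>(0, u)\<close> isolate it.\<close>

lemma port_hamiltonian_imp_psd:
  fixes E A :: "real^'n^'n" and B :: "real^'m^'n" and C :: "real^'n^'m" and D :: "real^'m^'m"
  assumes "port_hamiltonian E A B C D"
  shows "psd (D + transpose D)"
proof -
  obtain X :: "real^'n^'n" and Y Z where "psd (block_mat X Y Z ((1 / 2) *\<^sub>R (D + transpose D)))"
    using assms unfolding port_hamiltonian_def Let_def by blast
  note W = this[unfolded psd_def, THEN conjunct2, rule_format]
  have "0 \<le> u \<bullet> ((D + transpose D) *v u)" for u
    using W[of "\<chi> i. case i of Inl a \<Rightarrow> 0 | Inr b \<Rightarrow> u $ b"]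
    unfolding block_mat_quadratic_form
    by (simp add: zero_vec_def[symmetric] scaleR_matrix_vector_assoc[symmetric]
        del: transpose_matrix_vector)
  moreover have "transpose (D + transpose D) = D + transpose D"
    by (simp add: vec_eq_iff transpose_def)
  ultimately show ?thesis
    by (simp add: psd_def)
qed

text \<open>The required identities determine the matrices once \<open>Q\<close> is invertible:
  \<open>J\<close> and \<open>- R\<close> are the skew and symmetric parts of \<open>A Q^-1\<close>,
  and \<open>G - P = B\<close>, \<open>G + P = Q^-T C^T\<close> are solved for \<open>G\<close> and
  \<open>P\<close>. The quadratic form of the dissipation matrix at \<open>(a, u)\<close> is then
  the supply minus \<open>(Q *v a) \<bullet> (A *v a + B *v u)\<close>.\<close>

lemma port_hamiltonian_if_kyp:
  fixes E A :: "real^'n^'n" and B :: "real^'m^'n" and C :: "real^'n^'m" and D :: "real^'m^'m"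
  assumes sym: "transpose Q ** E = transpose E ** Q"
    and kyp: "\<And>x u. (Q *v x) \<bullet> (A *v x + B *v u) \<le> u \<bullet> (C *v x + D *v u)"
    and nonneg: "\<And>x. 0 \<le> (E *v x) \<bullet> (Q *v x)" and inv: "invertible Q"
  shows "port_hamiltonian E A B C D"
proof -
  obtain Qi where Qi: "Qi ** Q = mat 1" "Q ** Qi = mat 1"
    using inv unfolding invertible_def by blast
  have QiT: "transpose Q ** transpose Qi = mat 1"
    using Qi by (simp flip: matrix_transpose_mul)
  define X where "X = A ** Qi"
  define J where "J = (1 / 2) *\<^sub>R (X - transpose X)"
  define R where "R = - ((1 / 2) *\<^sub>R (X + transpose X))"
  define H where "H = transpose Qi ** transpose C"
  define G where "G = (1 / 2) *\<^sub>R (B + H)"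
  define P where "P = (1 / 2) *\<^sub>R (H - B)"
  define S where "S = (1 / 2) *\<^sub>R (D + transpose D)"
  define N where "N = (1 / 2) *\<^sub>R (D - transpose D)"
  have JR: "J - R = X" and GP: "G - P = B" "G + P = H" and SN: "S + N = D"
    by (simp_all add: J_def R_def G_def P_def S_def N_def vec_eq_iff field_simps)
  have A: "(J - R) ** Q = A"
    by (simp add: JR X_def Qi flip: matrix_mul_assoc)
  have C: "transpose (G + P) ** Q = C"
    by (simp add: GP H_def matrix_transpose_mul Qi flip: matrix_mul_assoc)
  have J: "transpose J = - J" and N: "transpose N = - N" and R: "transpose R = R" and S: "transpose S = S"
    by (simp_all add: J_def N_def R_def S_def vec_eq_iff transpose_def field_simps)
  have K: "block_mat J G (- transpose G) N = - transpose (block_mat J G (- transpose G) N)"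
  proof -
    have "transpose (- transpose G) = - G"
      by (simp add: vec_eq_iff transpose_def)
    then show ?thesis
      by (simp add: transpose_block_mat uminus_block_mat J N)
  qed
  have W: "psd (block_mat (transpose Q ** R ** Q) (transpose Q ** P) (transpose P ** Q) S)"
    unfolding psd_def
  proof (intro conjI allI)
    show "transpose (block_mat (transpose Q ** R ** Q) (transpose Q ** P) (transpose P ** Q) S)
        = block_mat (transpose Q ** R ** Q) (transpose Q ** P) (transpose P ** Q) S"
      by (simp add: transpose_block_mat matrix_transpose_mul R S matrix_mul_assoc)
    fix x :: "real^('n + 'm)"
    define a :: "real^'n" where "a = (\<chi> i. x $ Inl i)"
    define u :: "real^'m" where "u = (\<chi> i. x $ Inr i)"
    have "x \<bullet> (block_mat (transpose Q ** R ** Q) (transpose Q ** P) (transpose P ** Q) S *v x)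
        = (Q *v a) \<bullet> (R *v (Q *v a)) + 2 * ((Q *v a) \<bullet> (P *v u)) + u \<bullet> (S *v u)"
      unfolding block_mat_quadratic_form a_def[symmetric] u_def[symmetric]
      by (simp add: inner_add_right inner_transpose_mult inner_commute[of "P *v u"]
          del: transpose_matrix_vector flip: matrix_vector_mul_assoc)
    also have "(Q *v a) \<bullet> (R *v (Q *v a)) = - ((Q *v a) \<bullet> (A *v a))"
    proof -
      have "X *v (Q *v a) = A *v a"
        by (simp add: X_def matrix_vector_mul_assoc Qi flip: matrix_mul_assoc)
      moreover have "(Q *v a) \<bullet> (R *v (Q *v a))
          = - (1 / 2) * ((Q *v a) \<bullet> (X *v (Q *v a)) + (X *v (Q *v a)) \<bullet> (Q *v a))"
        unfolding R_def
        by (simp add: matrix_vector_mult_minus scaleR_matrix_vector_assoc[symmetric] matrix_vector_mult_add_rdistrib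
            inner_add_right inner_transpose_mult del: transpose_matrix_vector)
      ultimately show ?thesis
        by (simp add: inner_commute)
    qed
    also have "2 * ((Q *v a) \<bullet> (P *v u)) = u \<bullet> (C *v a) - (Q *v a) \<bullet> (B *v u)"
    proof -
      have "Qi *v (Q *v a) = a"
        by (simp add: matrix_vector_mul_assoc Qi)
      then have "(Q *v a) \<bullet> (H *v u) = (C *v a) \<bullet> u"
        unfolding H_def
        by (simp add: inner_transpose_mult del: transpose_matrix_vector flip: matrix_vector_mul_assoc)
      then show ?thesis
        unfolding P_def
        by (simp add: scaleR_matrix_vector_assoc[symmetric] matrix_vector_mult_diff_rdistrib
            inner_diff_right inner_commute)
    qed
    also have "u \<bullet> (S *v u) = u \<bullet> (D *v u)"
      unfolding S_def
      by (simp add: scaleR_matrix_vector_assoc[symmetric] matrix_vector_mult_add_rdistrib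
            inner_add_right inner_transpose_mult inner_commute del: transpose_matrix_vector)
    finally show "0 \<le> x \<bullet> (block_mat (transpose Q ** R ** Q) (transpose Q ** P) (transpose P ** Q) S *v x)"
      using kyp[of a u] by (simp add: inner_add_right)
  qed
  have E: "psd (transpose Q ** E)"
    unfolding psd_def
  proof (intro conjI allI)
    show "transpose (transpose Q ** E) = transpose Q ** E"
      by (simp add: matrix_transpose_mul sym)
    show "0 \<le> x \<bullet> (transpose Q ** E *v x)" for x
      using nonneg[of x]
      by (simp add: inner_transpose_mult inner_commute del: transpose_matrix_vector
          flip: matrix_vector_mul_assoc)
  qed
  show ?thesis
    unfolding port_hamiltonian_def Let_def
    by (rule exI[of _ J], rule exI[of _ R], rule exI[of _ Q], rule exI[of _ G], rule exI[of _ P])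
      (use A C K W E sym GP(1) SN in \<open>simp flip: S_def N_def\<close>)
qed

theorem theorem13:
  fixes E A :: "real^'n^'n"
    and B :: "real^'m^'n"
    and C :: "real^'n^'m"
    and D :: "real^'m^'m"
  assumes "regular_pencil E A"
    and "completely_controllable E A B"
    and "completely_observable E A C"
    and "positive_real E A B C D"
  shows "port_hamiltonian E A B C D \<longleftrightarrow> psd (D + transpose D)"
proof
  show "psd (D + transpose D)" if "port_hamiltonian E A B C D"
    using that by (rule port_hamiltonian_imp_psd)
  assume "psd (D + transpose D)"
  then have "positive_real_system (cmat E) (cmat A) (cmat B) (cmat C) (cmat D)"
    by (rule positive_real_system_cmat[OF assms])
  then show "port_hamiltonian E A B C D"
    by (rule real_kyp_solution) (rule port_hamiltonian_if_kyp)
qed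

end
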